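(* Let $G=\bigcup_{j=1}^m G_j$ be a finite union of bounded Jordan domains in $\mathbb{C}$ with pairwise disjoint closures, let $\mathcal{K}\subset G$ be compact, and let $G^\star=G\setminus\mathcal{K}$. Then, as $n\to\infty$: (a) $\gamma_n(G^\star)/\gamma_n(G)\to 1$; (b) $\|p_n(G^\star,\cdot)-p_n(G,\cdot)\|_{L^2(G)}\to 0$; (c) $\lambda_n(G^\star,z)/\lambda_n(G,z)\to 1$ uniformly on compact subsets of $\overline{\mathbb{C}}\setminus\overline{G}$; (d) $p_n(G^\star,z)/p_n(G,z)\to 1$ uniformly on compact subsets of $\overline{\mathbb{C}}\setminus \mathrm{Con}(G)$.
   Context: A bounded Jordan domain is the interior of a Jordan curve. $\overline{\mathbb{C}}=\mathbb{C}\cup\{\infty\}$ is the Riemann sphere. For $E\in\{G,G^\star\}$, $L^2(E)$ is the Lebesgue space with respect to area measure $dA$ on $E$, with inner product $\langle f,g\rangle_E=\int_E f\overline{g}\,dA$ and norm $\|f\|_{L^2(E)}=\langle f,f\rangle_E^{1/2}$. The Bergman polynomials $p_n(E,z)=\gamma_n(E)z^n+\cdots$, with $\gamma_n(E)>0$, $n=0,1,2,\ldots$, are the unique polynomials ($p_n$ of degree $n$) that are orthonormal with respect to $\langle\cdot,\cdot\rangle_E$. The Christoffel functions are $\lambda_n(E,z)=\inf\{\|P\|_{L^2(E)}^2 : P \text{ a complex polynomial of degree at most } n,\ P(z)=1\}$ for $z\in\mathbb{C}$; equivalently $1/\lambda_n(E,z)=\sum_{k=0}^n|p_k(E,z)|^2$.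 $\mathrm{Con}(G)$ denotes the (closed) convex hull of $G$, i.e. the convex hull of $\overline{G}$. At $z=\infty$ the ratios in (c) and (d) are understood as limits as $z\to\infty$. *)

theory Defs
  imports "HOL-Analysis.Analysis" "HOL-Computational_Algebra.Polynomial"
begin

definition bounded_jordan_domain :: "complex set \<Rightarrow> bool" where
  "bounded_jordan_domain D \<longleftrightarrow>
     (\<exists>c. simple_path c \<and> pathfinish c = pathstart c \<and> D = inside (path_image c))"

definition area_inner :: "complex set \<Rightarrow> (complex \<Rightarrow> complex) \<Rightarrow> (complex \<Rightarrow> complex) \<Rightarrow> complex" where
  "area_inner E f g = (LINT z:E|lebesgue. f z * cnj (g z))"

(* area_inner E f f is a nonnegative real number, embedded in the complex numbers. *)
definition area_norm :: "complex set \<Rightarrow> (complex \<Rightarrow> complex) \<Rightarrow> real" where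
  "area_norm E f = sqrt (Re (area_inner E f f))"

definition bergman_system :: "complex set \<Rightarrow> (nat \<Rightarrow> complex poly) \<Rightarrow> bool" where
  "bergman_system E p \<longleftrightarrow>
     (\<forall>n. degree (p n) = n \<and> (\<exists>c::real. c > 0 \<and> lead_coeff (p n) = of_real c)) \<and>
     (\<forall>m n. area_inner E (poly (p m)) (poly (p n)) = (if m = n then 1 else 0))"

(* The orthonormal system exists and is unique for every bounded nonempty open set E,
   which covers all sets it is used for. *)
definition bergman_poly :: "complex set \<Rightarrow> nat \<Rightarrow> complex poly" where
  "bergman_poly E = (THE p. bergman_system E p)"

(* The leading coefficient of bergman_poly E n is real; Re only adjusts the type. *)
definition bergman_gamma :: "complex set \<Rightarrow> nat \<Rightarrow> real" where
  "bergman_gamma E n = Re (lead_coeff (bergman_poly E n))"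

definition christoffel :: "complex set \<Rightarrow> nat \<Rightarrow> complex \<Rightarrow> real" where
  "christoffel E n z = Inf {(area_norm E (poly P))\<^sup>2 | P. degree P \<le> n \<and> poly P z = 1}"

(* One-point compactification of the plane: Some z is the finite point z, None is infinity. *)
abbreviation riemann_sphere :: "complex option topology" where
  "riemann_sphere \<equiv> Alexandroff_compactification euclidean"

definition sphere_ext :: "(complex \<Rightarrow> 'a::t2_space) \<Rightarrow> complex option \<Rightarrow> 'a" where
  "sphere_ext f w = (case w of Some z \<Rightarrow> f z | None \<Rightarrow> Lim at_infinity f)"

end

theory Submission
  imports Defs "HOL-Complex_Analysis.Conformal_Mappings"
begin

text \<open>
  Write \<open>p\<^sub>k\<close> for the Bergman polynomials of \<open>G \<setminus> K\<close>. By the mean value property near \<open>K\<close> and the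
  maximum principle, the kernel \<open>\<Sum>k\<le>n. \<bar>p\<^sub>k\<bar>\<^sup>2\<close> is bounded on \<open>K\<close> uniformly in \<open>n\<close>, so the series
  \<open>\<Sum>k. \<epsilon>\<^sub>k\<close> with \<open>\<epsilon>\<^sub>k = \<integral>\<^sub>K \<bar>p\<^sub>k\<bar>\<^sup>2\<close> converges. Expanding the norms of \<open>p\<^sub>n - p\<^sub>n(G)\<close> over \<open>G\<close> and over
  \<open>G \<setminus> K\<close> gives \<open>1 \<le> \<gamma>\<^sub>n(G \<setminus> K) / \<gamma>\<^sub>n(G) \<le> 1 + \<epsilon>\<^sub>n / 2\<close> and \<open>\<parallel>p\<^sub>n - p\<^sub>n(G)\<parallel>\<^sup>2 \<le> \<epsilon>\<^sub>n\<close>.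
  For the Christoffel functions one uses the extremal polynomial of \<open>G \<setminus> K\<close> as a competitor on \<open>G\<close>;
  the low-order part of its kernel is negligible because the closure of \<open>G\<close> has connected complement
  (Janiszewski), hence is polynomially convex. Off the convex hull, \<open>p\<^sub>n(G, z)\<close> dominates the square root
  of the kernel of \<open>G\<close> up to a constant, so that closeness in norm becomes closeness of the ratio.
\<close>

section \<open>Area integrals of polynomials\<close>

text \<open>The preimage of a box is a product of two intervals, and agreement on boxes determines
  Lebesgue measure. This opens the way to Fubini in real and imaginary parts.\<close>

lemma distr_Complex_lborel:
  "distr (lborel \<Otimes>\<^sub>M lborel) borel (\<lambda>(x, y). Complex x y) = lborel"
proof (rule lborel_eqI[symmetric])
  fix l u :: complex
  assume le: "\<And>b. b \<in> Basis \<Longrightarrow> l \<bullet> b \<le> u \<bullet> b"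
  have le': "Re l \<le> Re u" "Im l \<le> Im u"
    using le[of 1] le[of \<i>] by (auto simp: Basis_complex_def)
  have meas: "(\<lambda>(x, y). Complex x y) \<in> borel_measurable (lborel \<Otimes>\<^sub>M lborel)"
    by (auto simp: borel_measurable_complex_iff split_beta)
  have "(\<lambda>(x, y). Complex x y) -` box l u \<inter> space (lborel \<Otimes>\<^sub>M lborel)
      = {Re l<..<Re u} \<times> {Im l<..<Im u}"
    by (auto simp: space_pair_measure box_def Basis_complex_def)
  then show "emeasure (distr (lborel \<Otimes>\<^sub>M lborel) borel (\<lambda>(x, y). Complex x y)) (box l u) =
      (\<Prod>b\<in>Basis. (u - l) \<bullet> b)"
    using le' meas
    by (simp add: emeasure_distr lborel.emeasure_pair_measure_Times Basis_complex_def ennreal_mult)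
qed simp

lemma nn_integral_lborel_complex:
  fixes f :: "complex \<Rightarrow> ennreal"
  assumes [measurable]: "f \<in> borel_measurable borel"
  shows "(\<integral>\<^sup>+z. f z \<partial>lborel) = (\<integral>\<^sup>+x. \<integral>\<^sup>+y. f (Complex x y) \<partial>lborel \<partial>lborel)"
    and "(\<integral>\<^sup>+z. f z \<partial>lborel) = (\<integral>\<^sup>+y. \<integral>\<^sup>+x. f (Complex x y) \<partial>lborel \<partial>lborel)"
proof -
  have [measurable]: "(\<lambda>(x, y). Complex x y) \<in> borel_measurable (lborel \<Otimes>\<^sub>M lborel)"
    by (auto simp: borel_measurable_complex_iff split_beta)
  have [measurable]: "(\<lambda>(x, y). Complex x y) \<in> borel_measurable (borel \<Otimes>\<^sub>M borel)"
    by (auto simp: borel_measurable_complex_iff split_beta)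
  have 1: "(\<integral>\<^sup>+z. f z \<partial>lborel) = (\<integral>\<^sup>+p. f (case p of (x, y) \<Rightarrow> Complex x y) \<partial>(lborel \<Otimes>\<^sub>M lborel))"
    by (subst distr_Complex_lborel[symmetric], subst nn_integral_distr) auto
  show "(\<integral>\<^sup>+z. f z \<partial>lborel) = (\<integral>\<^sup>+x. \<integral>\<^sup>+y. f (Complex x y) \<partial>lborel \<partial>lborel)"
    unfolding 1 by (subst lborel.nn_integral_fst[symmetric]) (auto simp: split_beta)
  show "(\<integral>\<^sup>+z. f z \<partial>lborel) = (\<integral>\<^sup>+y. \<integral>\<^sup>+x. f (Complex x y) \<partial>lborel \<partial>lborel)"
    unfolding 1 by (subst lborel_pair.nn_integral_snd[symmetric]) (auto simp: split_beta)
qed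

text \<open>With the other coordinate held fixed, a shear is a translation of the inner integration
  variable.\<close>

lemma nn_integral_lborel_shear:
  fixes f :: "complex \<Rightarrow> ennreal"
  assumes [measurable]: "f \<in> borel_measurable borel"
  shows "(\<integral>\<^sup>+z. f (Complex (Re z + a * Im z) (Im z)) \<partial>lborel) = (\<integral>\<^sup>+z. f z \<partial>lborel)"
    and "(\<integral>\<^sup>+z. f (Complex (Re z) (Im z + a * Re z)) \<partial>lborel) = (\<integral>\<^sup>+z. f z \<partial>lborel)"
proof -
  have [measurable]: "(\<lambda>z. Complex (Re z + a * Im z) (Im z)) \<in> borel_measurable borel"
    "(\<lambda>z. Complex (Re z) (Im z + a * Re z)) \<in> borel_measurable borel"
    "\<And>c. Complex c \<in> borel_measurable borel" "\<And>c. (\<lambda>x. Complex x c) \<in> borel_measurable borel"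
    by (auto simp: borel_measurable_complex_iff)
  have [measurable]: "(\<lambda>x. f (Complex x c)) \<in> borel_measurable borel"
     "(\<lambda>x. f (Complex c x)) \<in> borel_measurable borel" for c
    by auto
  have "(\<integral>\<^sup>+x. f (Complex (x + a * y) y) \<partial>lborel) = (\<integral>\<^sup>+x. f (Complex x y) \<partial>lborel)" for y
    using nn_integral_real_affine[of "\<lambda>x. f (Complex x y)" 1 "a * y"] by (simp add: add.commute)
  then show "(\<integral>\<^sup>+z. f (Complex (Re z + a * Im z) (Im z)) \<partial>lborel) = (\<integral>\<^sup>+z. f z \<partial>lborel)"
    by (simp add: nn_integral_lborel_complex(2))
  have "(\<integral>\<^sup>+x. f (Complex y (x + a * y)) \<partial>lborel) = (\<integral>\<^sup>+x. f (Complex y x) \<partial>lborel)" for y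
    using nn_integral_real_affine[of "\<lambda>x. f (Complex y x)" 1 "a * y"] by (simp add: add.commute)
  then show "(\<integral>\<^sup>+z. f (Complex (Re z) (Im z + a * Re z)) \<partial>lborel) = (\<integral>\<^sup>+z. f z \<partial>lborel)"
    by (simp add: nn_integral_lborel_complex(1))
qed

text \<open>A rotation is a product of three shears, and a shear preserves area by Fubini.\<close>
lemma distr_cis_lborel:
  assumes "cos (\<theta>/2) \<noteq> 0"
  shows "distr lborel borel (\<lambda>z. cis \<theta> * z) = lborel"
proof (rule measure_eqI)
  fix A assume "A \<in> sets (distr lborel borel (\<lambda>z. cis \<theta> * z))"
  then have [measurable]: "A \<in> sets borel" by simp
  \<comment> \<open>Rotation by \<open>\<theta>\<close> factors as \<open>S\<close>,
    \<open>T\<close>, \<open>S\<close> with shear factors \<open>- tan (\<theta>/2)\<close>,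
    \<open>sin \<theta>\<close>, \<open>- tan (\<theta>/2)\<close>.\<close>
  define t where "t = tan (\<theta>/2)"
  have s2: "sin \<theta> = 2 * sin (\<theta>/2) * cos (\<theta>/2)" and c2: "cos \<theta> = 2 * (cos (\<theta>/2))\<^sup>2 - 1"
    using sin_double[of "\<theta>/2"] cos_double_cos[of "\<theta>/2"] by auto
  have ts: "1 - t * sin \<theta> = cos \<theta>" 
  proof -
    have "t * sin \<theta> = 2 * (sin (\<theta>/2))\<^sup>2"
      using assms by (simp add: t_def tan_def s2 power2_eq_square)
    then show ?thesis by (simp add: c2 sin_squared_eq)
  qed
  have tc: "t * (1 + cos \<theta>) = sin \<theta>"
    using assms unfolding t_def tan_def s2 c2 by (simp add: field_simps power2_eq_square)
  define f :: "complex \<Rightarrow> ennreal" where "f = indicator A"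
  define S where "S = (\<lambda>z. Complex (Re z + (- t) * Im z) (Im z))"
  define T where "T = (\<lambda>z. Complex (Re z) (Im z + sin \<theta> * Re z))"
  have S_eq: "Complex (Re z + (- t) * Im z) (Im z) = S z"
    and T_eq: "Complex (Re z) (Im z + sin \<theta> * Re z) = T z" for z
    by (simp_all only: S_def T_def)
  have [measurable]: "S \<in> borel_measurable borel" "T \<in> borel_measurable borel" "f \<in> borel_measurable borel"
    by (auto simp: borel_measurable_complex_iff S_def T_def f_def)
  have STS: "cis \<theta> * z = S (T (S z))" for z
  proof -
    have "Re (S (T (S z))) = (1 - t * sin \<theta>) * Re z - t * (1 + (1 - t * sin \<theta>)) * Im z"
      "Im (S (T (S z))) = sin \<theta> * Re z + (1 - t * sin \<theta>) * Im z"
      by (simp_all add: S_def T_def algebra_simps)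
    then show ?thesis
      by (simp add: complex_eq_iff ts tc)
  qed
  have "emeasure (distr lborel borel (\<lambda>z. cis \<theta> * z)) A = (\<integral>\<^sup>+z. f (cis \<theta> * z) \<partial>lborel)"
  proof -
    have "(\<lambda>z. f (cis \<theta> * z)) = indicator ((\<lambda>z. cis \<theta> * z) -` A)"
      by (auto simp: f_def indicator_def)
    moreover have "(\<lambda>z. cis \<theta> * z) -` A \<in> sets borel"
      using measurable_sets[of "\<lambda>z. cis \<theta> * z" borel borel A] by auto
    ultimately show ?thesis
      by (simp add: emeasure_distr)
  qed
  also have "\<dots> = (\<integral>\<^sup>+z. f (S (T (S z))) \<partial>lborel)" by (simp add: STS)
  also have "\<dots> = (\<integral>\<^sup>+z. f (S (T z)) \<partial>lborel)"
    using nn_integral_lborel_shear(1)[of "\<lambda>z. f (S (T z))" "- t", unfolded S_eq] by simp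
  also have "\<dots> = (\<integral>\<^sup>+z. f (S z) \<partial>lborel)"
    using nn_integral_lborel_shear(2)[of "\<lambda>z. f (S z)" "sin \<theta>", unfolded T_eq] by simp
  also have "\<dots> = (\<integral>\<^sup>+z. f z \<partial>lborel)"
    using nn_integral_lborel_shear(1)[of f "- t", unfolded S_eq] by simp
  finally show "emeasure (distr lborel borel (\<lambda>z. cis \<theta> * z)) A = emeasure lborel A"
    by (simp add: f_def)
qed simp

section \<open>Integrating polynomials over bounded sets; the mean value property\<close>

lemma set_integrable_continuous_bounded:
  fixes f :: "'a::euclidean_space \<Rightarrow> 'b::euclidean_space"
  assumes "bounded S" "S \<in> sets lebesgue" "continuous_on (closure S) f"
  shows "set_integrable lebesgue S f"
proof -
  have "compact (closure S)" using assms by (simp add: compact_closure)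
  then have "set_integrable lborel (closure S) f"
    using borel_integrable_compact[of "closure S" f] assms
    by (simp add: set_integrable_def indicator_scaleR_eq_if)
  then have "set_integrable lebesgue (closure S) f"
    unfolding set_integrable_def
    by (subst integrable_completion) (auto dest: borel_measurable_integrable)
  then show ?thesis
    using assms closure_subset set_integrable_subset by blast
qed

text \<open>Rotation by \<open>pi / (2 * k)\<close> preserves the disc and its area but multiplies
  \<open>z ^ k\<close> by \<open>\<i>\<close>, so the integral equals \<open>\<i>\<close> times
  itself.\<close>

lemma set_integral_ball_power_eq_0:
  assumes "k > 0"
  shows "(LINT z:ball 0 r|lebesgue. (z::complex) ^ k) = 0"
proof -
  define \<theta> where "\<theta> = pi / (2 * real k)"
  have "0 < \<theta> / 2" "\<theta> / 2 < pi / 2" using assms by (auto simp: \<theta>_def field_simps)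
  then have "cos (\<theta>/2) \<noteq> 0" using cos_gt_zero[of "\<theta>/2"] by simp
  note inv = distr_cis_lborel[OF this]
  define g where "g = (\<lambda>z::complex. indicator (ball 0 r) z *\<^sub>R z ^ k)"
  have [measurable]: "ball (0::complex) r \<in> sets borel" "(\<lambda>z::complex. z ^ k) \<in> borel_measurable borel"
    by (auto intro!: borel_measurable_continuous_onI continuous_intros)
  have [measurable]: "g \<in> borel_measurable borel" unfolding g_def by measurable
  have "(LINT z|lborel. g z) = (LINT z|lborel. g (cis \<theta> * z))"
    by (subst inv[symmetric], subst integral_distr) auto
  also have "\<dots> = (LINT z|lborel. \<i> * g z)"
  proof (rule Bochner_Integration.integral_cong)
    fix z :: complex
    have "real k * \<theta> = pi / 2" using assms by (simp add: \<theta>_def)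
    then have "cis \<theta> ^ k = \<i>" by (simp only: Complex.DeMoivre cis_pi_half)
    then show "g (cis \<theta> * z) = \<i> * g z"
      by (simp add: g_def power_mult_distrib indicator_def norm_mult)
  qed simp
  also have "\<dots> = \<i> * (LINT z|lborel. g z)" by simp
  finally have "(LINT z|lborel. g z) = 0"
    by (metis complex_i_not_one mult_cancel_right1)
  then show ?thesis
    unfolding set_lebesgue_integral_def g_def[symmetric] by (subst integral_completion) auto
qed

lemma set_integrable_poly:
  fixes p :: "complex poly"
  assumes "bounded S" "S \<in> sets lebesgue"
  shows "set_integrable lebesgue S (poly p)"
  using assms by (intro set_integrable_continuous_bounded continuous_intros) auto

lemma set_integral_sum:
  fixes f :: "'i \<Rightarrow> 'a \<Rightarrow> 'b::{banach, second_countable_topology}"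
  assumes "\<And>i. i \<in> I \<Longrightarrow> set_integrable M A (f i)"
  shows "(LINT x:A|M. (\<Sum>i\<in>I. f i x)) = (\<Sum>i\<in>I. LINT x:A|M. f i x)"
  using assms unfolding set_lebesgue_integral_def set_integrable_def
  by (simp add: scaleR_sum_right)

text \<open>Once the centre is moved to 0, positive powers integrate to 0 and only the constant term
  is left, which is the value at the centre.\<close>

lemma set_integral_ball_poly:
  fixes p :: "complex poly"
  shows "(LINT z:ball a r|lebesgue. poly p z) = of_real (measure lebesgue (ball a r)) * poly p a"
proof -
  define q where "q = p \<circ>\<^sub>p [:a, 1:]"
  have q: "poly q z = poly p (z + a)" for z by (simp add: q_def poly_pcompose add.commute)
  have [measurable]: "ball a r \<in> sets borel" "poly p \<in> borel_measurable borel" "poly q \<in> borel_measurable borel"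
    by (auto intro!: borel_measurable_continuous_onI continuous_intros)
  have *: "(LINT z:ball b r|lebesgue. poly p' z) = (LINT z|lborel. indicator (ball b r) z *\<^sub>R poly p' z)"
    if [measurable]: "poly p' \<in> borel_measurable borel" for p' :: "complex poly" and b
  proof -
    have [measurable]: "ball b r \<in> sets borel" by simp
    show ?thesis unfolding set_lebesgue_integral_def by (subst integral_completion) auto
  qed
  have "(LINT z:ball a r|lebesgue. poly p z) = (LINT z|lborel. indicator (ball a r) z *\<^sub>R poly p z)"
    by (rule *) simp
  also have "\<dots> = (LINT z|lborel. indicator (ball a r) (a + z) *\<^sub>R poly p (a + z))"
    by (subst lborel_distr_plus[of a, symmetric], subst integral_distr) auto
  also have "\<dots> = (LINT z|lborel. indicator (ball 0 r) z *\<^sub>R poly q z)"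
    by (intro Bochner_Integration.integral_cong) (auto simp: q indicator_def dist_norm add.commute)
  also have "\<dots> = (LINT z:ball 0 r|lebesgue. poly q z)"
    by (rule *[symmetric]) simp
  also have "\<dots> = (LINT z:ball 0 r|lebesgue. (\<Sum>k\<le>degree q. coeff q k * z ^ k))"
    by (simp add: poly_altdef)
  also have "\<dots> = (\<Sum>k\<le>degree q. LINT z:ball 0 r|lebesgue. coeff q k * z ^ k)"
    by (intro set_integral_sum set_integrable_continuous_bounded continuous_intros) auto
  also have "\<dots> = (\<Sum>k\<le>degree q. coeff q k * (LINT z:ball 0 r|lebesgue. z ^ k))"
    by simp
  also have "\<dots> = (\<Sum>k\<le>degree q. if k = 0 then coeff q k * (LINT z:ball (0::complex) r|lebesgue. 1) else 0)"
    by (intro sum.cong) (auto simp: set_integral_ball_power_eq_0)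
  also have "\<dots> = coeff q 0 * (LINT z:ball (0::complex) r|lebesgue. 1)"
    by simp
  also have "(LINT z:ball (0::complex) r|lebesgue. 1) = complex_of_real (measure lebesgue (ball (0::complex) r))"
    using fmeasurableD2[OF lmeasurable_ball, of "0::complex" r]
    by (subst set_integral_const) (auto simp: scaleR_conv_of_real)
  also have "coeff q 0 = poly p a" using q[of 0] by (simp add: poly_0_coeff_0)
  also have "measure lebesgue (ball (0::complex) r) = measure lebesgue (ball a r)"
    using measure_translation[of a "ball 0 r"] by (simp add: ball_translation)
  finally show ?thesis by (simp add: mult.commute)
qed

text \<open>The mean value property is applied to the square of the polynomial.\<close>
lemma norm_poly_le_set_integral:
  fixes p :: "complex poly"
  assumes "ball a r \<subseteq> S" "bounded S" "S \<in> sets lebesgue"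
  shows "measure lebesgue (ball a r) * (cmod (poly p a))\<^sup>2 \<le> (LINT z:S|lebesgue. (cmod (poly p z))\<^sup>2)"
proof -
  have "measure lebesgue (ball a r) * (cmod (poly p a))\<^sup>2
      = cmod (LINT z:ball a r|lebesgue. poly (p ^ 2) z)"
    unfolding set_integral_ball_poly by (simp add: norm_mult norm_power)
  also have "\<dots> \<le> (LINT z:ball a r|lebesgue. cmod (poly (p ^ 2) z))"
    by (intro set_integral_norm_bound set_integrable_poly) auto
  also have "\<dots> = (LINT z:ball a r|lebesgue. (cmod (poly p z))\<^sup>2)"
    by (simp add: norm_power)
  also have "\<dots> \<le> (LINT z:S|lebesgue. (cmod (poly p z))\<^sup>2)"
  proof -
    have int: "set_integrable lebesgue T (\<lambda>z. (cmod (poly p z))\<^sup>2)"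
      if "bounded T" "T \<in> sets lebesgue" for T
      using that by (intro set_integrable_continuous_bounded continuous_intros) auto
    show ?thesis
      using int[of S] int[of "ball a r"] assms
      unfolding set_lebesgue_integral_def set_integrable_def
      by (intro integral_mono) (auto simp: indicator_def)
  qed
  finally show ?thesis .
qed

section \<open>Polynomial convexity\<close>

text \<open>By compactness the peak is strict with a ratio \<open>q < 1\<close>; normalised powers
  of \<open>Q\<close> then decay on \<open>E\<close> like \<open>q ^ k\<close>.\<close>

lemma poly_peak_power:
  fixes E :: "complex set"
  assumes "compact E" and Q: "\<And>w. w \<in> E \<Longrightarrow> cmod (poly Q w) < cmod (poly Q z)" and e: "e > 0"
  shows "\<exists>P. poly P z = 1 \<and> (\<forall>w\<in>E. cmod (poly P w) \<le> e)"
proof (cases "E = {}")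
  case True
  then show ?thesis by (intro exI[of _ 1]) simp
next
  case ne: False
  have "continuous_on E (\<lambda>w. cmod (poly Q w))" by (intro continuous_intros)
  then obtain w0 where w0: "w0 \<in> E" "\<And>w. w \<in> E \<Longrightarrow> cmod (poly Q w) \<le> cmod (poly Q w0)"
    using continuous_attains_sup[OF assms(1) ne] by blast
  define q where "q = cmod (poly Q w0) / cmod (poly Q z)"
  have pos: "cmod (poly Q z) > 0" using Q[OF w0(1)] by (meson norm_ge_zero order_le_less_trans)
  have "0 \<le> q" "q < 1" using Q[OF w0(1)] pos by (auto simp: q_def)
  then obtain k where k: "q ^ k < e" using real_arch_pow_inv[of e q] e by blast
  let ?R = "smult (1 / poly Q z ^ k) (Q ^ k)"
  have "cmod (poly ?R w) \<le> e" if "w \<in> E" for w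
  proof -
    have "cmod (poly ?R w) = (cmod (poly Q w) / cmod (poly Q z)) ^ k"
      by (simp add: norm_mult norm_power norm_divide power_divide)
    also have "\<dots> \<le> q ^ k"
      unfolding q_def using w0(2)[OF that] pos by (intro power_mono divide_right_mono) auto
    finally show ?thesis using k by simp
  qed
  moreover have "poly ?R z = 1" using pos by simp
  ultimately show ?thesis by blast
qed

text \<open>A form of Runge's theorem. If the complement of the polynomial hull has a limit point \<open>z\<^sub>0\<close> in the hull
  but off \<open>E\<close>, take \<open>Q\<close> peaking at a point \<open>z\<^sub>1\<close> very close to \<open>z\<^sub>0\<close>: then \<open>(1 - Q(w)) / (w - z\<^sub>1)\<close> is larger at
  \<open>z\<^sub>0\<close> than on \<open>E\<close>, a contradiction. So that complement is open and closed in \<open>- E\<close>.\<close>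
lemma exists_poly_peak_at:
  fixes E :: "complex set"
  assumes "compact E" "connected (- E)" "z \<notin> E"
  obtains Q where "\<And>w. w \<in> E \<Longrightarrow> cmod (poly Q w) < cmod (poly Q z)"
proof (cases "E = {}")
  case True
  show ?thesis by (rule that[of 1]) (simp add: True)
next
  case ne: False
  define U where "U = {z. \<exists>Q. \<forall>w\<in>E. cmod (poly Q w) < cmod (poly Q z)}"
  have peak: "\<exists>Q. poly Q z = 1 \<and> (\<forall>w\<in>E. cmod (poly Q w) \<le> e)" if zU: "z \<in> U" and e: "e > 0" for z and e :: real
    using zU poly_peak_power[OF assms(1) _ e] unfolding U_def by blast
  have "open U"
    unfolding open_dist
  proof (intro ballI)
    fix z assume "z \<in> U"
    then obtain Q where Q: "poly Q z = 1" "\<And>w. w \<in> E \<Longrightarrow> cmod (poly Q w) \<le> 1/2"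
      using peak[of z "1/2"] by auto
    have "isCont (\<lambda>w. cmod (poly Q w)) z" by (intro continuous_intros)
    then have "\<forall>\<^sub>F w in nhds z. cmod (poly Q w) > 1/2"
      using Q(1) order_tendstoD(1)[of "\<lambda>w. cmod (poly Q w)" "cmod (poly Q z)" "at z" "1/2"]
      unfolding isCont_def by (simp add: eventually_nhds_conv_at)
    then show "\<exists>e>0. \<forall>y. dist y z < e \<longrightarrow> y \<in> U"
      unfolding eventually_nhds_metric U_def using Q(2) by (blast intro: le_less_trans)
  qed
  have UE: "U \<subseteq> - E" by (auto simp: U_def)
  have closed_in_compl: "z0 \<in> U" if z0: "z0 \<in> - E" "z0 \<in> closure U" for z0
  proof (rule ccontr)
    assume "z0 \<notin> U"
    define d where "d = infdist z0 E"
    have "d > 0" unfolding d_def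
      using z0 ne compact_imp_closed[OF assms(1)] by (metis ComplD in_closed_iff_infdist_zero infdist_nonneg less_eq_real_def)
    then obtain z1 where z1: "z1 \<in> U" "dist z1 z0 < d/4"
      using z0(2) unfolding closure_approachable by (metis zero_less_divide_iff zero_less_numeral)
    obtain Q where Q: "poly Q z1 = 1" "\<And>w. w \<in> E \<Longrightarrow> cmod (poly Q w) \<le> 1/4"
      using peak[OF z1(1), of "1/4"] by auto
    \<comment> \<open>With \<open>R = (1 - Q) / (w - z1)\<close>: at \<open>z0\<close> the numerator
      is at least 3/4 and the denominator below \<open>d/4\<close>, so the modulus of
      \<open>R\<close> is at least \<open>3/d\<close>; on \<open>E\<close> these are at most 5/4 and
      at least \<open>3/4 * d\<close>, so it is at most \<open>(5/3) / d\<close>.\<close>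
    have "[:- z1, 1:] dvd 1 - Q" using Q(1) by (simp add: poly_eq_0_iff_dvd[symmetric])
    then obtain R where R: "1 - Q = [:- z1, 1:] * R" by (elim dvdE)
    have R': "1 - poly Q w = (w - z1) * poly R w" for w
      using arg_cong[OF R, of "\<lambda>p. poly p w"] by (simp add: algebra_simps)
    obtain w0 where "w0 \<in> E" "cmod (poly Q z0) \<le> cmod (poly Q w0)"
      using \<open>z0 \<notin> U\<close> by (auto simp: U_def not_less)
    then have "cmod (poly Q z0) \<le> 1/4" using Q(2) by force
    then have "3/4 \<le> cmod (1 - poly Q z0)"
      using norm_triangle_ineq2[of 1 "poly Q z0"] by simp
    also have "\<dots> = dist z0 z1 * cmod (poly R z0)" by (simp add: R' norm_mult dist_norm)
    also have "\<dots> \<le> d/4 * cmod (poly R z0)"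
      using z1(2) by (intro mult_right_mono) (auto simp: dist_commute)
    finally have big: "3 / d \<le> cmod (poly R z0)" using \<open>d > 0\<close> by (simp add: field_simps)
    obtain w1 where w1: "w1 \<in> E" "cmod (poly R z0) \<le> cmod (poly R w1)"
      using \<open>z0 \<notin> U\<close> by (auto simp: U_def not_less)
    have "d \<le> dist z0 w1" using infdist_le[OF w1(1)] by (simp add: d_def)
    then have "3/4 * d \<le> dist w1 z1" using z1(2) dist_triangle[of z0 w1 z1]
      by (simp add: dist_commute)
    then have "3/4 * d * cmod (poly R w1) \<le> dist w1 z1 * cmod (poly R w1)"
      by (intro mult_right_mono) auto
    also have "\<dots> = cmod (1 - poly Q w1)" by (simp add: R' norm_mult dist_norm)
    also have "\<dots> \<le> 5/4" using norm_triangle_ineq4[of 1 "poly Q w1"] Q(2)[OF w1(1)] by simp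
    finally have "cmod (poly R w1) \<le> (5/3) / d" using \<open>d > 0\<close> by (simp add: field_simps)
    moreover have "(5/3) / d < 3 / d" using \<open>d > 0\<close> by (simp add: divide_simps)
    ultimately show False using big w1(2) by linarith
  qed
  have "closedin (top_of_set (- E)) U"
    unfolding closedin_limpt using UE closed_in_compl by (auto simp: closure_def)
  moreover have "openin (top_of_set (- E)) U"
    using \<open>open U\<close> UE by (simp add: openin_open_eq[of "- E"] open_subset)
  \<comment> \<open>Outside a disc containing \<open>E\<close> the identity polynomial already
    peaks.\<close>
  moreover have "U \<noteq> {}"
  proof -
    obtain B where B: "B > 0" "\<And>w. w \<in> E \<Longrightarrow> cmod w \<le> B"
      using compact_imp_bounded[OF assms(1)] by (auto simp: bounded_pos)
    have "of_real (B + 1) \<in> U"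
      unfolding U_def using B by (auto intro!: exI[of _ "[:0, 1:]"] simp: norm_of_real simp del: of_real_add) force
    then show ?thesis by blast
  qed
  ultimately have "U = - E"
    using assms(2) by (metis connected_clopen)
  then have "z \<in> U" using assms(3) by simp
  then show ?thesis using that unfolding U_def by blast
qed

section \<open>Jordan domains and the complement of their union\<close>

lemma bounded_jordan_domain_properties:
  assumes "bounded_jordan_domain D"
  shows "open D" "bounded D" "D \<noteq> {}" "connected (- closure D)"
proof -
  obtain c where c: "simple_path c" "pathfinish c = pathstart c" "D = inside (path_image c)"
    using assms by (auto simp: bounded_jordan_domain_def)
  note J = Jordan_inside_outside[OF c(1,2)]
  show "open D" "bounded D" "D \<noteq> {}" using J c(3) by auto
  \<comment> \<open>The frontier of the inside is the curve, so the complement of the closure is the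
    outside, connected by the Jordan curve theorem.\<close>
  have "closure D = inside (path_image c) \<union> path_image c"
    using J c(3) by (simp add: closure_Un_frontier)
  moreover have "- \<dots> = outside (path_image c)"
    using union_with_inside[of "path_image c"] by auto
  ultimately show "connected (- closure D)" using J by simp
qed

text \<open>Induction with Janiszewski's theorem: two compact sets with connected complements and
  connected, here empty, intersection do not separate the plane together.\<close>

lemma connected_Compl_disjoint_UN:
  fixes F :: "'i \<Rightarrow> complex set"
  assumes "finite I" "\<And>i. i \<in> I \<Longrightarrow> compact (F i)" "\<And>i. i \<in> I \<Longrightarrow> connected (- F i)"
    "disjoint_family_on F I"
  shows "connected (- (\<Union>i\<in>I. F i))"
  using assms
proof (induction I rule: finite_induct)
  case empty
  then show ?case by (simp add: connected_UNIV)
next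
  case (insert i I)
  have "F i \<inter> (\<Union>j\<in>I. F j) = {}"
    using insert.prems(3) insert.hyps by (auto simp: disjoint_family_on_def)
  moreover have "connected (- (\<Union>j\<in>I. F j))"
    using insert.prems by (intro insert.IH) (auto simp: disjoint_family_on_def)
  moreover have "compact (\<Union>j\<in>I. F j)"
    using insert by (intro compact_UN) auto
  ultimately have "connected (- (F i \<union> (\<Union>j\<in>I. F j)))"
    using insert.prems by (intro Janiszewski_connected) (auto simp: compact_imp_closed)
  then show ?case by simp
qed

section \<open>Bergman polynomials and their kernels\<close>

text \<open>Cancel the coefficient at \<open>n\<close> with a multiple of \<open>f n\<close> and
  recurse. The bound on \<open>r\<close> is put in terms of coefficients so that
  \<open>n = 0\<close> says \<open>r = 0\<close>, which no degree bound expresses.\<close>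

lemma poly_in_span_degree_basis:
  fixes f :: "nat \<Rightarrow> 'a::field poly"
  assumes "\<And>k. k < n \<Longrightarrow> degree (f k) = k \<and> f k \<noteq> 0" "\<And>i. i \<ge> n \<Longrightarrow> coeff r i = 0"
  shows "\<exists>a. r = (\<Sum>k<n. smult (a k) (f k))"
  using assms
proof (induction n arbitrary: r)
  case 0
  then have "r = 0" by (intro poly_eqI) simp
  then show ?case by simp
next
  case (Suc n)
  define c where "c = coeff r n / lead_coeff (f n)"
  have f: "degree (f n) = n" "f n \<noteq> 0" using Suc.prems(1)[of n] by auto
  have "coeff (r - smult c (f n)) i = 0" if "i \<ge> n" for i
  proof (cases "i = n")
    case True then show ?thesis using f leading_coeff_0_iff[of "f n"] by (simp add: c_def)
  next
    case False then show ?thesis using that f Suc.prems(2)[of i] by (simp add: coeff_eq_0)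
  qed
  then obtain a where a: "r - smult c (f n) = (\<Sum>k<n. smult (a k) (f k))"
    using Suc.IH[of "r - smult c (f n)"] Suc.prems(1) by auto
  have "r = (\<Sum>k<Suc n. smult ((a(n := c)) k) (f k))"
    using a by (simp add: algebra_simps)
  then show ?case by blast
qed

section \<open>Norms and inner products of polynomials\<close>

definition sqnorm :: "complex set \<Rightarrow> complex poly \<Rightarrow> real" where
  "sqnorm E p = (LINT z:E|lebesgue. (cmod (poly p z))\<^sup>2)"

lemma set_integrable_norm_poly:
  assumes "bounded E" "E \<in> sets lebesgue"
  shows "set_integrable lebesgue E (\<lambda>z. (cmod (poly p z))\<^sup>2)"
  using assms by (intro set_integrable_continuous_bounded continuous_intros) auto

definition poly_inner :: "complex set \<Rightarrow> complex poly \<Rightarrow> complex poly \<Rightarrow> complex" where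
  "poly_inner E p q = area_inner E (poly p) (poly q)"

lemma poly_inner_self: "poly_inner E p p = of_real (sqnorm E p)"
  by (simp add: poly_inner_def area_inner_def sqnorm_def complex_norm_square[symmetric] flip: set_integral_complex_of_real)

lemma area_norm_poly: "area_norm E (poly p) = sqrt (sqnorm E p)"
  using poly_inner_self[of E p] by (simp add: area_norm_def poly_inner_def)

lemma sqnorm_nonneg: "0 \<le> sqnorm E p"
  unfolding sqnorm_def set_lebesgue_integral_def by (intro Bochner_Integration.integral_nonneg) auto

lemma sqnorm_smult: "sqnorm E (smult c p) = (cmod c)\<^sup>2 * sqnorm E p"
  by (simp add: sqnorm_def norm_mult power_mult_distrib)

lemma sqnorm_mono_pointwise:
  assumes "bounded E" "E \<in> sets lebesgue" "\<And>z. z \<in> E \<Longrightarrow> cmod (poly p z) \<le> cmod (poly q z)"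
  shows "sqnorm E p \<le> sqnorm E q"
  unfolding sqnorm_def using assms
  by (intro set_integral_mono set_integrable_norm_poly power_mono) auto

lemma sqnorm_Diff:
  assumes "bounded G" "G \<in> sets lebesgue" "K \<in> sets lebesgue" "K \<subseteq> G"
  shows "sqnorm G p = sqnorm (G - K) p + sqnorm K p"
proof -
  have "bounded K" "bounded (G - K)" using assms by (auto intro: bounded_subset)
  then have "(LINT z:(G - K) \<union> K|lebesgue. (cmod (poly p z))\<^sup>2) = sqnorm (G - K) p + sqnorm K p"
    unfolding sqnorm_def using assms
    by (intro set_integral_Un set_integrable_norm_poly) auto
  moreover have "(G - K) \<union> K = G" using assms by auto
  ultimately show ?thesis by (simp add: sqnorm_def)
qed

text \<open>A locale because the theory is instantiated twice, for \<open>G\<close> and for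
  \<open>G - K\<close>.\<close>

locale planar_domain =
  fixes E :: "complex set"
  assumes open_E: "open E" and bounded_E: "bounded E" and nonempty_E: "E \<noteq> {}"
begin

lemma sets_E: "E \<in> sets lebesgue"
  using open_E by (simp add: borel_open)

lemma integrable_continuous:
  fixes f :: "complex \<Rightarrow> 'b::euclidean_space"
  shows "continuous_on (closure E) f \<Longrightarrow> set_integrable lebesgue E f"
  using bounded_E sets_E by (rule set_integrable_continuous_bounded)

abbreviation ip where "ip \<equiv> poly_inner E"

lemma integrable_ip: "set_integrable lebesgue E (\<lambda>z. poly p z * cnj (poly q z))"
  by (intro integrable_continuous continuous_intros)

lemma ip_add_left: "ip (p + q) r = ip p r + ip q r"
  unfolding poly_inner_def area_inner_def by (simp add: distrib_right set_integral_add(2) integrable_ip)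

lemma ip_smult_left: "ip (smult c p) r = c * ip p r"
  unfolding poly_inner_def area_inner_def by (simp add: mult.assoc)

lemma ip_cnj: "cnj (ip p q) = ip q p"
  unfolding poly_inner_def area_inner_def set_lebesgue_integral_def
  by (subst Bochner_Integration.integral_cnj[symmetric]) (simp add: mult.commute)

lemma ip_zero_left: "ip 0 r = 0"
  using ip_smult_left[of 0 0 r] by simp

lemma ip_diff_left: "ip (p - q) r = ip p r - ip q r"
proof -
  have "p - q = p + smult (-1) q" by simp
  then have "ip (p - q) r = ip p r + (-1) * ip q r"
    by (metis ip_add_left ip_smult_left)
  then show ?thesis by simp
qed

lemma ip_sum_left: "ip (\<Sum>k\<in>A. f k) r = (\<Sum>k\<in>A. ip (f k) r)"
  by (induction A rule: infinite_finite_induct) (auto simp: ip_zero_left ip_add_left)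

lemma ip_diff_right: "ip r (p - q) = ip r p - ip r q"
  by (metis ip_cnj ip_diff_left complex_cnj_diff)

lemma ip_smult_right: "ip r (smult c p) = cnj c * ip r p"
  by (metis ip_cnj ip_smult_left complex_cnj_mult)

lemma ip_sum_right: "ip r (\<Sum>k\<in>A. f k) = (\<Sum>k\<in>A. ip r (f k))"
proof -
  have "ip r (\<Sum>k\<in>A. f k) = cnj (\<Sum>k\<in>A. ip (f k) r)"
    by (metis ip_cnj ip_sum_left)
  then show ?thesis by (simp add: ip_cnj)
qed

text \<open>By the mean value inequality on small discs, zero norm forces a zero at every point of
  the infinite set \<open>E\<close>.\<close>

lemma sqnorm_eq_0_iff: "sqnorm E p = 0 \<longleftrightarrow> p = 0"
proof
  assume 0: "sqnorm E p = 0"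
  have "E \<subseteq> {z. poly p z = 0}"
  proof
    fix a assume "a \<in> E"
    then obtain r where r: "r > 0" "ball a r \<subseteq> E" using open_E open_contains_ball by blast
    have "measure lebesgue (ball a r) * (cmod (poly p a))\<^sup>2 \<le> 0"
      using norm_poly_le_set_integral[OF r(2) bounded_E sets_E, of p] 0 by (simp add: sqnorm_def)
    moreover have "measure lebesgue (ball a r) > 0"
      using content_ball_pos[OF r(1), of a] by simp
    ultimately have "(cmod (poly p a))\<^sup>2 \<le> 0"
      by (metis mult_pos_pos not_less)
    then show "a \<in> {z. poly p z = 0}" by simp
  qed
  moreover have "infinite E"
    using open_E nonempty_E finite_imp_not_open by blast
  ultimately show "p = 0"
    using poly_roots_finite[of p] finite_subset by blast
qed (simp add: sqnorm_def)

lemma sqnorm_pos: "p \<noteq> 0 \<Longrightarrow> sqnorm E p > 0"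
  using sqnorm_eq_0_iff sqnorm_nonneg by (metis less_eq_real_def)

section \<open>Existence and uniqueness of the Bergman polynomials\<close>

definition orthonormal_at :: "nat \<Rightarrow> complex poly \<Rightarrow> bool" where
  "orthonormal_at n p \<longleftrightarrow> degree p = n \<and> (\<exists>c::real. c > 0 \<and> lead_coeff p = of_real c)
     \<and> (\<forall>q. degree q < n \<longrightarrow> ip p q = 0) \<and> ip p p = 1"

lemma orthonormal_at_nonzero: "orthonormal_at n p \<Longrightarrow> degree p = n \<and> p \<noteq> 0"
  by (auto simp: orthonormal_at_def)

text \<open>Gram-Schmidt: subtract from \<open>monom 1 n\<close> its projection \<open>s\<close>
  onto the lower polynomials and normalise by a positive real, which keeps the leading coefficient
  positive.\<close>

lemma orthonormal_at_exists: "\<exists>p. orthonormal_at n p"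
proof (induction n rule: less_induct)
  case (less n)
  then obtain f where f: "\<And>k. k < n \<Longrightarrow> orthonormal_at k (f k)" by metis
  have orth: "ip (f j) (f k) = (if j = k then 1 else 0)" if "j < n" "k < n" for j k
  proof (cases j k rule: linorder_cases)
    case less
    then have "ip (f k) (f j) = 0" using f[OF \<open>j < n\<close>] f[OF \<open>k < n\<close>] by (auto simp: orthonormal_at_def)
    then show ?thesis using ip_cnj[of "f k" "f j"] less by simp
  next
    case equal then show ?thesis using f[OF \<open>j < n\<close>] by (auto simp: orthonormal_at_def)
  next
    case greater then show ?thesis using f[OF \<open>j < n\<close>] f[OF \<open>k < n\<close>] by (auto simp: orthonormal_at_def)
  qed
  define s where "s = (\<Sum>k<n. smult (ip (monom 1 n) (f k)) (f k))"
  define q where "q = monom 1 n - s"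
  have "coeff (f k) i = 0" if "k < n" "n \<le> i" for k i
    using f[OF that(1)] that by (intro coeff_eq_0) (auto simp: orthonormal_at_def)
  then have "coeff s i = 0" if "i \<ge> n" for i
    using that by (simp add: s_def coeff_sum)
  then have cq: "coeff q n = 1" "\<And>i. i > n \<Longrightarrow> coeff q i = 0" by (auto simp: q_def)
  then have dq: "degree q = n"
    by (metis degree_le le_degree one_neq_zero order_antisym)
  have "q \<noteq> 0" using cq by auto
  have qf: "ip q (f k) = 0" if "k < n" for k
  proof -
    have "ip s (f k) = (\<Sum>j<n. if j = k then ip (monom 1 n) (f k) else 0)"
      unfolding s_def ip_sum_left ip_smult_left using orth that by (intro sum.cong) auto
    then show ?thesis using that by (simp add: q_def ip_diff_left)
  qed
  define c where "c = 1 / sqrt (sqnorm E q)"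
  have "sqnorm E q > 0" using \<open>q \<noteq> 0\<close> by (rule sqnorm_pos)
  then have c: "c > 0" "c\<^sup>2 * sqnorm E q = 1" by (auto simp: c_def power_divide)
  have "orthonormal_at n (smult (of_real c) q)"
    unfolding orthonormal_at_def
  proof (intro conjI allI impI)
    show "degree (smult (complex_of_real c) q) = n" using dq c by simp
    show "\<exists>ca>0. lead_coeff (smult (complex_of_real c) q) = complex_of_real ca"
      using c dq cq by auto
    show "ip (smult (complex_of_real c) q) r = 0" if deg: "degree r < n" for r
    proof -
      obtain a where "r = (\<Sum>k<n. smult (a k) (f k))"
        using poly_in_span_degree_basis[of n f r] orthonormal_at_nonzero[OF f] deg
        by (meson coeff_eq_0 less_le_trans)
      then show ?thesis
        by (simp add: ip_smult_left ip_sum_right ip_smult_right qf)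
    qed
    have "ip (smult (complex_of_real c) q) (smult (complex_of_real c) q) = of_real (c\<^sup>2 * sqnorm E q)"
      unfolding poly_inner_self sqnorm_smult using c by simp
    then show "ip (smult (complex_of_real c) q) (smult (complex_of_real c) q) = 1"
      using c by simp
  qed
  then show ?case by blast
qed

text \<open>With \<open>c\<close> matching the leading coefficients, the difference \<open>r\<close>
  has lower degree, so it is orthogonal to \<open>p\<close> and \<open>q\<close> and hence to
  itself. Unit norms and positivity then give \<open>c = 1\<close>.\<close>

lemma orthonormal_at_unique:
  assumes "orthonormal_at n p" "orthonormal_at n q"
  shows "p = q"
proof -
  obtain a b :: real where ab: "a > 0" "b > 0" "lead_coeff p = of_real a" "lead_coeff q = of_real b"
    and deg: "degree p = n" "degree q = n"
    using assms by (auto simp: orthonormal_at_def)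
  define c where "c = a / b"
  define r where "r = p - smult (of_real c) q"
  have "r = 0"
  \<comment> \<open>No degree lies below 0, so constants are compared directly.\<close>
  proof (cases "n = 0")
    case True
    then show ?thesis
      using deg ab by (auto elim!: degree_eq_zeroE simp: r_def c_def)
  next
    case False
    have "coeff r i = 0" if "i \<ge> n" for i
      using that deg ab by (cases "i = n") (auto simp: r_def c_def coeff_eq_0)
    then have "degree r < n"
      using False by (metis degree_0 le_neq_implies_less leading_coeff_0_iff nat_le_linear not_gr_zero)
    then have "ip r r = ip p r - c * ip q r" "ip p r = 0" "ip q r = 0"
      using assms by (auto simp: r_def ip_diff_left ip_smult_left orthonormal_at_def)
    then show "r = 0" using sqnorm_eq_0_iff[of r] by (simp add: poly_inner_self)
  qed
  then have pq: "p = smult (of_real c) q" by (simp add: r_def)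
  have "c > 0" using ab by (simp add: c_def)
  have "of_real (c\<^sup>2) * ip q q = ip p p"
    unfolding pq poly_inner_self sqnorm_smult by simp
  then have "complex_of_real (c\<^sup>2) = 1" using assms by (simp add: orthonormal_at_def)
  then have "c = 1" using \<open>c > 0\<close> 
    by (metis of_real_eq_1_iff less_imp_le power2_eq_1_iff less_minus_one_simps(1) not_less_iff_gr_or_eq order.asym)
  then show ?thesis using pq by simp
qed

lemma bergman_system_poly_inner:
  "bergman_system E p \<longleftrightarrow>
     (\<forall>n. degree (p n) = n \<and> (\<exists>c::real. c > 0 \<and> lead_coeff (p n) = of_real c)) \<and>
     (\<forall>m n. ip (p m) (p n) = (if m = n then 1 else 0))"
  by (simp add: bergman_system_def poly_inner_def)

text \<open>The lower members of a system span all polynomials of lower degree, so pairwise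
  orthogonality can be checked one index at a time. Existence and uniqueness of the system thus
  reduce to a single index.\<close>

lemma bergman_system_iff: "bergman_system E p \<longleftrightarrow> (\<forall>n. orthonormal_at n (p n))"
proof
  assume B: "bergman_system E p"
  then have deg: "degree (p k) = k" and nz: "p k \<noteq> 0" for k
    by (auto simp: bergman_system_poly_inner) (metis leading_coeff_0_iff less_irrefl of_real_eq_0_iff)
  have lead: "\<exists>c::real. c > 0 \<and> lead_coeff (p k) = of_real c" for k
    using B unfolding bergman_system_poly_inner by blast
  have ip: "ip (p j) (p k) = (if j = k then 1 else 0)" for j k
    using B unfolding bergman_system_poly_inner by blast
  have "ip (p n) q = 0" if q: "degree q < n" for n q
  proof -
    obtain a where "q = (\<Sum>k<n. smult (a k) (p k))"
      using poly_in_span_degree_basis[of n p q] deg nz q by (meson coeff_eq_0 less_le_trans)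
    then show ?thesis
      by (simp add: ip_sum_right ip_smult_right ip)
  qed
  then show "\<forall>n. orthonormal_at n (p n)"
    unfolding orthonormal_at_def using deg lead ip by simp
next
  assume "\<forall>n. orthonormal_at n (p n)"
  then have P: "orthonormal_at n (p n)" for n by blast
  show "bergman_system E p"
    unfolding bergman_system_poly_inner
  proof (intro conjI allI)
    fix j k
    show "ip (p j) (p k) = (if j = k then 1 else 0)"
    proof (cases j k rule: linorder_cases)
      case less
      then have "ip (p k) (p j) = 0" using P[of j] P[of k] by (auto simp: orthonormal_at_def)
      then show ?thesis using ip_cnj[of "p k" "p j"] less by simp
    qed (use P[of j] P[of k] in \<open>auto simp: orthonormal_at_def\<close>)
  next
    fix n
    show "degree (p n) = n" "\<exists>c>0. lead_coeff (p n) = complex_of_real c"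
      using P[of n] unfolding orthonormal_at_def by blast+
  qed
qed

lemma bergman_system_bergman_poly: "bergman_system E (bergman_poly E)"
proof -
  obtain p where p: "\<And>n. orthonormal_at n (p n)" using orthonormal_at_exists by metis
  have "\<exists>!p. bergman_system E p"
  proof
    show "bergman_system E p" using p by (simp add: bergman_system_iff)
    show "q = p" if "bergman_system E q" for q
      using that p orthonormal_at_unique unfolding bergman_system_iff by (intro ext) blast
  qed
  then show ?thesis unfolding bergman_poly_def by (rule theI')
qed

abbreviation bp :: "nat \<Rightarrow> complex poly" where "bp \<equiv> bergman_poly E"
abbreviation gam :: "nat \<Rightarrow> real" where "gam \<equiv> bergman_gamma E"

lemma degree_bp [simp]: "degree (bp n) = n"
  using bergman_system_bergman_poly by (simp add: bergman_system_poly_inner)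

lemma ip_bp: "ip (bp m) (bp n) = (if m = n then 1 else 0)"
  using bergman_system_bergman_poly by (simp add: bergman_system_poly_inner)

lemma lead_coeff_bp: "coeff (bp n) n = of_real (gam n)"
  and gam_pos: "gam n > 0"
proof -
  obtain c :: real where "c > 0" "lead_coeff (bp n) = of_real c"
    using bergman_system_bergman_poly unfolding bergman_system_poly_inner by blast
  then show "coeff (bp n) n = of_real (gam n)" "gam n > 0" by (auto simp: bergman_gamma_def)
qed

lemma bp_nonzero [simp]: "bp n \<noteq> 0"
  using lead_coeff_bp[of n] gam_pos[of n] by auto

lemma sqnorm_bp: "sqnorm E (bp n) = 1"
  using ip_bp[of n n] unfolding poly_inner_self by (simp only: of_real_eq_1_iff if_True refl)

lemma bp_orthogonal: "degree q < n \<Longrightarrow> ip (bp n) q = 0"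
  using bergman_system_bergman_poly unfolding bergman_system_iff orthonormal_at_def by blast

lemma bp_expansion:
  assumes "degree r \<le> n"
  shows "r = (\<Sum>k\<le>n. smult (ip r (bp k)) (bp k))"
proof -
  obtain a where a: "r = (\<Sum>k<Suc n. smult (a k) (bp k))"
    using poly_in_span_degree_basis[of "Suc n" bp r] assms
    by (metis bp_nonzero coeff_eq_0 degree_bp le_imp_less_Suc less_le_trans)
  have "ip r (bp k) = a k" if "k < Suc n" for k
  proof -
    have "ip r (bp k) = (\<Sum>j<Suc n. if j = k then a k else 0)"
      by (subst a, unfold ip_sum_left ip_smult_left) (intro sum.cong, auto simp: ip_bp)
    then show ?thesis using that by simp
  qed
  then have "(\<Sum>k<Suc n. smult (a k) (bp k)) = (\<Sum>k<Suc n. smult (ip r (bp k)) (bp k))"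
    by (intro sum.cong) auto
  then show ?thesis using a by (simp only: lessThan_Suc_atMost)
qed

section \<open>Reproducing kernels and Christoffel functions\<close>

definition kernel :: "nat \<Rightarrow> complex \<Rightarrow> complex poly" where
  "kernel n z = (\<Sum>k\<le>n. smult (cnj (poly (bp k) z)) (bp k))"

text \<open>The reproducing kernel on the diagonal; it is also the squared norm of
  \<open>kernel n z\<close> and the reciprocal of the Christoffel function.\<close>

definition kdiag :: "nat \<Rightarrow> complex \<Rightarrow> real" where
  "kdiag n z = (\<Sum>k\<le>n. (cmod (poly (bp k) z))\<^sup>2)"

lemma degree_kernel: "degree (kernel n z) \<le> n"
  unfolding kernel_def by (intro degree_sum_le) (auto intro: order_trans[OF degree_smult_le])

lemma poly_kernel: "poly (kernel n z) w = (\<Sum>k\<le>n. cnj (poly (bp k) z) * poly (bp k) w)"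
  by (simp add: kernel_def poly_sum)

lemma poly_kernel_self: "poly (kernel n z) z = of_real (kdiag n z)"
  unfolding poly_kernel kdiag_def of_real_sum complex_norm_square
  by (simp add: mult.commute)

lemma kernel_reproducing:
  assumes "degree r \<le> n"
  shows "ip r (kernel n z) = poly r z"
proof -
  have "poly r z = (\<Sum>k\<le>n. ip r (bp k) * poly (bp k) z)"
    by (subst bp_expansion[OF assms]) (simp add: poly_sum)
  then show ?thesis
    by (simp add: kernel_def ip_sum_right ip_smult_right mult.commute)
qed

lemma sqnorm_kernel: "sqnorm E (kernel n z) = kdiag n z"
  using kernel_reproducing[OF degree_kernel, of n z z]
  unfolding poly_kernel_self poly_inner_self by (simp only: of_real_eq_iff)

lemma kdiag_mono: "m \<le> n \<Longrightarrow> kdiag m z \<le> kdiag n z"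
  unfolding kdiag_def by (intro sum_mono2) auto

lemma kdiag_pos: "kdiag n z > 0"
proof -
  have "poly (bp 0) z \<noteq> 0"
    by (metis bp_nonzero degree_bp degree_eq_zeroE poly_0 poly_pCons mult_zero_right add_0_right pCons_0_0)
  then have "0 < kdiag 0 z" by (simp add: kdiag_def)
  then show ?thesis using kdiag_mono[of 0 n z] by simp
qed

text \<open>The Cauchy--Schwarz inequality, read off from the norm of \<open>r - c K\<close> with \<open>c\<close> chosen so that this difference vanishes at \<open>z\<close>.\<close>
lemma norm_poly_le_kdiag:
  assumes "degree r \<le> n"
  shows "(cmod (poly r z))\<^sup>2 \<le> sqnorm E r * kdiag n z"
proof -
  define K where "K = kernel n z"
  define c where "c = poly r z / of_real (kdiag n z)"
  have K: "ip r K = poly r z" "ip K K = of_real (kdiag n z)"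
    using assms by (simp_all add: K_def kernel_reproducing poly_inner_self sqnorm_kernel)
  have Kr: "ip K r = cnj (poly r z)" using ip_cnj[of r K] K by simp
  have "ip (r - smult c K) (r - smult c K) = ip r r - cnj c * poly r z - c * cnj (poly r z) + c * cnj c * kdiag n z"
    by (simp add: ip_diff_left ip_diff_right ip_smult_left ip_smult_right K Kr algebra_simps)
  also have "\<dots> = ip r r - poly r z * cnj (poly r z) / kdiag n z"
    using kdiag_pos[of n z] by (simp add: c_def field_simps)
  finally have "sqnorm E (r - smult c K) = sqnorm E r - (cmod (poly r z))\<^sup>2 / kdiag n z"
    unfolding poly_inner_self complex_norm_square[symmetric]
    by (metis of_real_diff of_real_divide of_real_eq_iff)
  then have "(cmod (poly r z))\<^sup>2 / kdiag n z \<le> sqnorm E r"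
    using sqnorm_nonneg[of E "r - smult c K"] by linarith
  then show ?thesis using kdiag_pos[of n z] by (simp add: field_simps)
qed

text \<open>The minimiser is the kernel divided by its value at \<open>z\<close>; the lower bound is
  the Cauchy-Schwarz inequality \<open>norm_poly_le_kdiag\<close>.\<close>

lemma christoffel_eq: "christoffel E n z = 1 / kdiag n z"
  unfolding christoffel_def area_norm_poly
proof (rule cInf_eq_minimum)
  define P where "P = smult (1 / of_real (kdiag n z)) (kernel n z)"
  have "degree P \<le> n" "poly P z = 1"
    using degree_kernel[of n z] kdiag_pos[of n z] degree_smult_le order_trans
    by (auto simp: P_def poly_kernel_self)
  moreover have "(sqrt (sqnorm E P))\<^sup>2 = 1 / kdiag n z"
    using kdiag_pos[of n z]
    by (simp add: sqnorm_nonneg) (simp add: P_def sqnorm_smult sqnorm_kernel norm_divide power2_eq_square)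
  ultimately show "1 / kdiag n z \<in> {(sqrt (sqnorm E P))\<^sup>2 |P. degree P \<le> n \<and> poly P z = 1}"
    by (metis (mono_tags, lifting) mem_Collect_eq)
next
  fix x assume "x \<in> {(sqrt (sqnorm E P))\<^sup>2 |P. degree P \<le> n \<and> poly P z = 1}"
  then obtain P where P: "x = sqnorm E P" "degree P \<le> n" "poly P z = 1"
    by (auto simp: sqnorm_nonneg)
  then show "1 / kdiag n z \<le> x"
    using norm_poly_le_kdiag[OF P(2), of z] kdiag_pos[of n z] by (simp add: field_simps)
qed

end

text \<open>The point is a degree bound uniform over \<open>T\<close>, which may be unbounded.
  Beyond radius \<open>R = B / \<epsilon>\<close> the linear polynomial \<open>w / z\<close> serves;
  within that radius compactness leaves finitely many peaking polynomials.\<close>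

lemma exists_poly_small_on_compact:
  fixes E T :: "complex set"
  assumes "compact E" "connected (- E)" "closed T" "T \<inter> E = {}" "\<epsilon> > 0"
  obtains d where "\<And>z. z \<in> T \<Longrightarrow>
    \<exists>Q. degree Q \<le> d \<and> poly Q z = 1 \<and> (\<forall>w\<in>E. cmod (poly Q w) \<le> \<epsilon>)"
proof -
  obtain B where B: "B > 0" "\<And>w. w \<in> E \<Longrightarrow> cmod w \<le> B"
    using compact_imp_bounded[OF assms(1)] by (auto simp: bounded_pos)
  define R where "R = B / \<epsilon>"
  have "R > 0" using B assms by (simp add: R_def)
  have far: "\<exists>Q. degree Q \<le> 1 \<and> poly Q z = 1 \<and> (\<forall>w\<in>E. cmod (poly Q w) \<le> \<epsilon>)" if "cmod z > R" for z
  proof (intro exI conjI ballI)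
    have z: "cmod z > 0" "\<epsilon> * cmod z > B" using that \<open>R > 0\<close> assms(5) by (auto simp: R_def field_simps)
    then show "poly [:0, 1 / z:] z = 1" by auto
    show "cmod (poly [:0, 1 / z:] w) \<le> \<epsilon>" if "w \<in> E" for w
      using B(2)[OF that] z by (simp add: norm_mult norm_divide field_simps)
  qed simp
  \<comment> \<open>The bound \<open>\<epsilon> / 2\<close> leaves room to renormalise at nearby
    points, where the modulus is only known to exceed 1/2.\<close>
  have "\<exists>P. poly P z = 1 \<and> (\<forall>w\<in>E. cmod (poly P w) \<le> \<epsilon> / 2)" if "z \<in> T" for z
  proof -
    have "z \<notin> E" using that assms(4) by auto
    then obtain Q where "\<And>w. w \<in> E \<Longrightarrow> cmod (poly Q w) < cmod (poly Q z)"
      using exists_poly_peak_at[OF assms(1,2)] by metis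
    then show ?thesis
      using poly_peak_power[OF assms(1), of Q z "\<epsilon> / 2"] assms(5) by simp
  qed
  then obtain P where P: "\<And>z. z \<in> T \<Longrightarrow> poly (P z) z = 1"
    "\<And>z w. z \<in> T \<Longrightarrow> w \<in> E \<Longrightarrow> cmod (poly (P z) w) \<le> \<epsilon> / 2"
    by metis
  define U where "U = (\<lambda>z. {y. cmod (poly (P z) y) > 1/2})"
  have "open (U z)" for z
    unfolding U_def by (intro open_Collect_less continuous_intros)
  moreover have "compact (T \<inter> cball 0 R)"
    using assms(3) by (simp add: closed_Int_compact)
  moreover have "T \<inter> cball 0 R \<subseteq> (\<Union>z\<in>T \<inter> cball 0 R. U z)"
    using P(1) by (auto simp: U_def)
  ultimately obtain F where F: "F \<subseteq> T \<inter> cball 0 R" "finite F" "T \<inter> cball 0 R \<subseteq> (\<Union>z\<in>F. U z)"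
    by (metis compactE_image)
  define d where "d = Max (insert 1 ((\<lambda>z. degree (P z)) ` F))"
  have d: "1 \<le> d" "\<And>z. z \<in> F \<Longrightarrow> degree (P z) \<le> d"
    using F(2) by (auto simp: d_def)
  show ?thesis
  proof (rule that)
    fix y assume y: "y \<in> T"
    show "\<exists>Q. degree Q \<le> d \<and> poly Q y = 1 \<and> (\<forall>w\<in>E. cmod (poly Q w) \<le> \<epsilon>)"
    proof (cases "cmod y > R")
      case True
      then show ?thesis using far[OF True] d(1) le_trans by blast
    next
      case False
      then obtain z where z: "z \<in> F" "y \<in> U z" using y F(3) by (auto simp: not_less)
      define Q where "Q = smult (1 / poly (P z) y) (P z)"
      have y2: "cmod (poly (P z) y) > 1/2" using z by (simp add: U_def)
      have "cmod (poly Q w) \<le> \<epsilon>" if "w \<in> E" for w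
      proof -
        have "cmod (poly (P z) w) \<le> \<epsilon> * (1/2)"
          using P(2)[OF _ that, of z] z F(1) by auto
        also have "\<dots> \<le> \<epsilon> * cmod (poly (P z) y)"
          using y2 assms(5) by (intro mult_left_mono) auto
        finally show ?thesis
          using y2 assms(5) by (simp add: Q_def norm_mult norm_divide divide_simps split: if_splits)
      qed
      moreover have "poly Q y = 1" using y2 by (auto simp: Q_def)
      moreover have "degree Q \<le> d" using d(2)[OF z(1)] by (simp add: Q_def)
      ultimately show ?thesis by blast
    qed
  qed
qed

lemma poly_ratio_tendsto_at_infinity:
  fixes p q :: "complex poly"
  assumes "degree p = degree q" "q \<noteq> 0"
  shows "((\<lambda>z. poly p z / poly q z) \<longlongrightarrow> lead_coeff p / lead_coeff q) at_infinity"
proof -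
  have "((\<lambda>z. (poly p z / z ^ degree p) / (poly q z / z ^ degree q)) \<longlongrightarrow> lead_coeff p / lead_coeff q) at_infinity"
    using assms by (intro tendsto_divide poly_divide_tendsto_aux) auto
  moreover have "\<forall>\<^sub>F z in at_infinity. (poly p z / z ^ degree p) / (poly q z / z ^ degree q) = poly p z / poly q z"
    using eventually_not_equal_at_infinity[of "0::complex"] by eventually_elim (simp add: assms)
  ultimately show ?thesis using filterlim_cong by fastforce
qed

text \<open>On the boundary of a neighbourhood of \<open>K\<close> the mean value inequality applies to discs that avoid \<open>K\<close>; the maximum principle carries the bound over to \<open>K\<close>.\<close>
lemma poly_bound_on_removed_compact:
  fixes G K :: "complex set"
  assumes "open G" "bounded G" "compact K" "K \<subseteq> G"
  obtains C where "C > 0" "\<And>p z. z \<in> K \<Longrightarrow> (cmod (poly p z))\<^sup>2 \<le> C * sqnorm (G - K) p"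
proof (cases "K = {}")
  case True
  show ?thesis by (rule that[of 1]) (auto simp: True)
next
  case ne: False
  obtain e where e: "e > 0" "(\<Union>x\<in>K. ball x e) \<subseteq> G"
    using compact_subset_open_imp_ball_epsilon_subset[OF assms(3,1,4)] by blast
  \<comment> \<open>Half of \<open>e\<close>, so that a disc of radius \<open>\<delta>\<close> about
    a point at distance \<open>\<delta>\<close> from \<open>K\<close> still lies in
    \<open>G\<close>.\<close>
  define \<delta> where "\<delta> = e / 2"
  have "\<delta> > 0" using e by (simp add: \<delta>_def)
  define U where "U = {z. infdist z K \<le> \<delta>}"
  have near: "\<exists>x\<in>K. infdist z K = dist z x" for z
    using infdist_attains_inf[OF compact_imp_closed[OF assms(3)] ne] by metis
  have "U \<subseteq> G"
  proof
    fix z assume "z \<in> U"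
    then obtain x where "x \<in> K" "dist z x \<le> \<delta>" using near[of z] by (auto simp: U_def)
    then have "z \<in> ball x e" using e(1) by (auto simp: \<delta>_def dist_commute)
    then show "z \<in> G" using e(2) \<open>x \<in> K\<close> by blast
  qed
  then have "bounded U" using assms(2) bounded_subset by blast
  have "K \<subseteq> U" using \<open>\<delta> > 0\<close> by (auto simp: U_def)
  have fr: "infdist z K = \<delta>" if "z \<in> frontier U" for z
  proof -
    have "closed U" unfolding U_def by (intro closed_Collect_le continuous_intros)
    then have "z \<in> U" "z \<notin> interior U" using that by (auto simp: frontier_def)
    moreover have "{z. infdist z K < \<delta>} \<subseteq> interior U"
      unfolding U_def by (intro interior_maximal open_Collect_less continuous_intros) auto
    ultimately show ?thesis by (force simp: U_def)
  qed
  define C where "C = 1 / measure lebesgue (ball (0::complex) \<delta>)"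
  have mpos: "measure lebesgue (ball (z::complex) \<delta>) > 0" for z
    using content_ball_pos[OF \<open>\<delta> > 0\<close>, of z] by simp
  show ?thesis
  proof (rule that)
    show "C > 0" using mpos by (simp add: C_def)
    fix p z assume "z \<in> K"
    have "cmod (poly p w) \<le> sqrt (C * sqnorm (G - K) p)" if w: "w \<in> frontier U" for w
    proof -
      have "ball w \<delta> \<subseteq> G - K"
      proof
        fix y assume y: "y \<in> ball w \<delta>"
        have "y \<notin> K" using fr[OF w] infdist_le[of y K w] y by (auto simp: dist_commute)
        moreover obtain x where x: "x \<in> K" "dist w x = \<delta>" using near[of w] fr[OF w] by auto
        then have "y \<in> ball x e" using y dist_triangle[of x y w] by (auto simp: \<delta>_def dist_commute)
        ultimately show "y \<in> G - K" using e(2) x by blast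
      qed
      then have 1: "measure lebesgue (ball w \<delta>) * (cmod (poly p w))\<^sup>2 \<le> sqnorm (G - K) p"
        unfolding sqnorm_def using assms
        by (intro norm_poly_le_set_integral) (auto simp: bounded_diff borel_open borel_compact sets.Diff)
      have 2: "measure lebesgue (ball w \<delta>) = measure lebesgue (ball (0::complex) \<delta>)"
        using measure_translation[of w "ball 0 \<delta>"] by (simp add: ball_translation)
      have "(cmod (poly p w))\<^sup>2 \<le> sqnorm (G - K) p / measure lebesgue (ball (0::complex) \<delta>)"
        using 1 unfolding 2 pos_le_divide_eq[OF mpos] by (subst mult.commute)
      then have "(cmod (poly p w))\<^sup>2 \<le> C * sqnorm (G - K) p"
        unfolding C_def by simp
      then show ?thesis by (rule real_le_rsqrt)
    qed
    note bound = this
    have "cmod (poly p z) \<le> sqrt (C * sqnorm (G - K) p)"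
    proof (rule maximum_modulus_frontier[of "poly p" U])
      show "poly p holomorphic_on interior U" by (intro holomorphic_intros)
      show "continuous_on (closure U) (poly p)" by (intro continuous_intros)
      show "cmod (poly p w) \<le> sqrt (C * sqnorm (G - K) p)" if "w \<in> frontier U" for w
        using that by (rule bound)
      show "z \<in> U" using \<open>K \<subseteq> U\<close> \<open>z \<in> K\<close> by blast
    qed (rule \<open>bounded U\<close>)
    from power_mono[OF this norm_ge_zero, of 2]
    show "(cmod (poly p z))\<^sup>2 \<le> C * sqnorm (G - K) p"
      using \<open>C > 0\<close> sqnorm_nonneg[of "G - K" p] by simp
  qed
qed

text \<open>Compact sets are closed in the Hausdorff sphere. If infinity belongs to
  \<open>S\<close>, the finite part may be unbounded, so the estimates off \<open>G\<close> are made
  for closed sets.\<close>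

lemma closed_vimage_Some_compactin:
  assumes "compactin riemann_sphere S"
  shows "closed (Some -` S)"
proof -
  have "closedin riemann_sphere S"
    using assms
    by (intro compactin_imp_closedin) (auto simp: Hausdorff_space_Alexandroff_compactification Hausdorff_space_euclidean locally_compact_space_euclidean)
  then have "closedin euclidean {z \<in> topspace euclidean. Some z \<in> S}"
    by (rule closedin_continuous_map_preimage[OF continuous_map_Some])
  then show ?thesis by (simp add: vimage_def)
qed

section \<open>Growth of kernels and Bergman polynomials off the domain\<close>

context planar_domain
begin

lemma sqnorm_diff:
  "sqnorm E (p - q) = sqnorm E p + sqnorm E q - 2 * Re (ip p q)"
proof -
  have "complex_of_real (sqnorm E (p - q)) = ip p p - ip p q - cnj (ip p q) + ip q q"
    unfolding poly_inner_self[symmetric] ip_cnj by (simp add: ip_diff_left ip_diff_right)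
  then show ?thesis by (simp add: poly_inner_self complex_eq_iff)
qed

text \<open>Only the top term of the expansion reaches degree \<open>n\<close>. For Bergman
  polynomials of two different sets this makes their inner product a ratio of leading
  coefficients.\<close>

lemma ip_bp_eq_coeff:
  assumes "degree P \<le> n"
  shows "ip P (bp n) = coeff P n / gam n"
proof -
  have "coeff P n = coeff (\<Sum>k\<le>n. smult (ip P (bp k)) (bp k)) n"
    using bp_expansion[OF assms] by simp
  also have "\<dots> = (\<Sum>k\<le>n. if k = n then ip P (bp n) * gam n else 0)"
    unfolding coeff_sum by (intro sum.cong) (auto simp: lead_coeff_bp coeff_eq_0)
  also have "\<dots> = ip P (bp n) * gam n" by simp
  finally show ?thesis using gam_pos[of n] by simp
qed

text \<open>Test Cauchy-Schwarz on \<open>kernel N z * Q\<close>: its value at \<open>z\<close> is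
  unchanged, its norm shrinks by \<open>\<epsilon>\<close> and its degree grows by at most
  \<open>d\<close>.\<close>

lemma kdiag_le_of_small_poly:
  assumes "degree Q \<le> d" "poly Q z = 1" "\<And>w. w \<in> E \<Longrightarrow> cmod (poly Q w) \<le> \<epsilon>" "\<epsilon> > 0"
  shows "kdiag N z \<le> \<epsilon>\<^sup>2 * kdiag (N + d) z"
proof -
  define r where "r = kernel N z * Q"
  have "degree r \<le> N + d"
    unfolding r_def using degree_mult_le[of "kernel N z" Q] degree_kernel[of N z] assms(1) by linarith
  from norm_poly_le_kdiag[OF this, of z]
  have "(kdiag N z)\<^sup>2 \<le> sqnorm E r * kdiag (N + d) z"
    using kdiag_pos[of N z] by (simp add: r_def assms poly_kernel_self)
  also have "sqnorm E r \<le> sqnorm E (smult (of_real \<epsilon>) (kernel N z))"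
    using assms(3,4) by (intro sqnorm_mono_pointwise bounded_E sets_E)
      (auto simp: r_def norm_mult mult.commute intro: mult_right_mono)
  also have "\<dots> = \<epsilon>\<^sup>2 * kdiag N z" by (simp add: sqnorm_smult sqnorm_kernel)
  finally have "(kdiag N z)\<^sup>2 \<le> \<epsilon>\<^sup>2 * kdiag N z * kdiag (N + d) z"
    using kdiag_pos[of "N + d" z] by simp
  then have "kdiag N z * kdiag N z \<le> kdiag N z * (\<epsilon>\<^sup>2 * kdiag (N + d) z)"
    by (simp add: power2_eq_square mult_ac)
  then show ?thesis using kdiag_pos[of N z] by simp
qed

lemma kdiag_tendsto_at_infinity:
  "((\<lambda>z. kdiag n z / (cmod (poly (bp n) z))\<^sup>2) \<longlongrightarrow> 1) at_infinity"
proof -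
  have "((\<lambda>z. \<Sum>k\<le>n. (cmod (poly (bp k) z / poly (bp n) z))\<^sup>2) \<longlongrightarrow> (\<Sum>k\<le>n. if k = n then 1 else 0)) at_infinity"
  proof (intro tendsto_sum)
    fix k assume "k \<in> {..n}"
    show "((\<lambda>z. (cmod (poly (bp k) z / poly (bp n) z))\<^sup>2) \<longlongrightarrow> (if k = n then 1 else 0)) at_infinity"
    proof (cases "k = n")
      case True
      have "((\<lambda>z. (cmod (poly (bp n) z / poly (bp n) z))\<^sup>2) \<longlongrightarrow> (cmod (lead_coeff (bp n) / lead_coeff (bp n)))\<^sup>2) at_infinity"
        by (intro tendsto_power tendsto_norm poly_ratio_tendsto_at_infinity) auto
      then show ?thesis using True lead_coeff_bp[of n] gam_pos[of n] by simp
    next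
      case False
      then have "degree (bp k) < degree (bp n)" using \<open>k \<in> {..n}\<close> by simp
      then have "((\<lambda>z. (cmod (poly (bp k) z / poly (bp n) z))\<^sup>2) \<longlongrightarrow> (cmod 0)\<^sup>2) at_infinity"
        by (intro tendsto_power tendsto_norm poly_divide_tendsto_0_at_infinity)
      then show ?thesis using False by simp
    qed
  qed
  then show ?thesis
    by (simp add: kdiag_def sum_divide_distrib norm_divide power_divide)
qed

text \<open>For \<open>Q = p\<^sub>n - (p\<^sub>n(z) / K(z,z)) K(\<cdot>,z)\<close> the quotient \<open>R(w) = Q(w) / (w - z)\<close> has degree less than \<open>n\<close>, so it is orthogonal to \<open>p\<^sub>n\<close>. Since the convex hull lies on one side of a line that misses \<open>z\<close>, the part of \<open>\<langle>R, p\<^sub>n\<rangle>\<close> coming from \<open>\<bar>p\<^sub>n\<bar>\<^sup>2 / (w - z)\<close> cannot cancel.\<close>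
lemma sqrt_kdiag_le_bp:
  assumes z: "\<And>w. w \<in> convex hull (closure E) \<Longrightarrow> d \<le> dist z w" and "d > 0"
    and M: "\<And>v w. v \<in> convex hull (closure E) \<Longrightarrow> w \<in> convex hull (closure E) \<Longrightarrow> dist v w \<le> M"
  shows "sqrt (kdiag n z) \<le> (1 + M / d)\<^sup>2 * cmod (poly (bp n) z)"
proof -
  define H where "H = convex hull (closure E)"
  have "compact H" using bounded_E by (simp add: H_def compact_convex_hull compact_closure)
  have "convex H" by (simp add: H_def)
  have EH: "E \<subseteq> H" unfolding H_def using closure_subset hull_subset by fast
  then have "H \<noteq> {}" using nonempty_E by auto
  then obtain a where a: "a \<in> H" "\<And>w. w \<in> H \<Longrightarrow> dist z a \<le> dist z w"
    using distance_attains_inf[OF compact_imp_closed[OF \<open>compact H\<close>], of z] by auto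
  define \<delta> where "\<delta> = dist z a"
  have \<delta>: "\<delta> \<ge> d" "\<delta> > 0" using z[of a] a(1) \<open>d > 0\<close> by (auto simp: \<delta>_def H_def)
  have "M \<ge> 0" using M[of a a] a(1) by (simp add: H_def)
  \<comment> \<open>\<open>Re ((a - z) / (w - z))\<close> is an inner product over a squared
    distance. The numerator is at least the square of \<open>\<delta>\<close>, as \<open>a\<close>
    is the hull point nearest to \<open>z\<close>; the distance is at most
    \<open>\<delta> + M\<close>.\<close>
  define c where "c = (\<delta> / (\<delta> + M))\<^sup>2"
  have "c > 0" using \<delta> \<open>M \<ge> 0\<close> by (simp add: c_def)
  have geom: "\<delta> \<le> cmod (w - z)" "c \<le> Re ((a - z) / (w - z))" if "w \<in> E" for w
  proof -
    have w: "w \<in> H" using that EH by auto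
    show 1: "\<delta> \<le> cmod (w - z)" using a(2)[OF w] by (simp add: \<delta>_def dist_norm norm_minus_commute)
    have 2: "cmod (w - z) \<le> \<delta> + M"
      using M[of a w] a(1) w dist_triangle[of z w a] by (simp add: H_def \<delta>_def dist_norm norm_minus_commute)
    have "(z - a) \<bullet> (w - a) \<le> 0"
      using \<open>convex H\<close> \<open>compact H\<close> compact_imp_closed a w by (intro any_closest_point_dot[of H]) auto
    then have 3: "\<delta>\<^sup>2 \<le> (a - z) \<bullet> (w - z)"
      unfolding \<delta>_def dist_norm power2_norm_eq_inner by (simp add: inner_diff_left inner_diff_right inner_commute)
    have "0 \<le> (a - z) \<bullet> (w - z)" using order_trans[OF zero_le_power2 3] .
    note 3 this
    moreover have "Re ((a - z) / (w - z)) = ((a - z) \<bullet> (w - z)) / (cmod (w - z))\<^sup>2"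
      by (simp add: Re_divide inner_complex_def cmod_power2)
    moreover have "(cmod (w - z))\<^sup>2 \<le> (\<delta> + M)\<^sup>2" using 2 by (intro power_mono) auto
    ultimately show "c \<le> Re ((a - z) / (w - z))"
      unfolding c_def power_divide using 1 \<delta> by (auto intro!: frac_le)
  qed
  define K where "K = kernel n z"
  define t where "t = sqrt (kdiag n z)"
  have t: "t > 0" "t\<^sup>2 = kdiag n z" using kdiag_pos[of n z] by (auto simp: t_def)
  define \<alpha> where "\<alpha> = poly (bp n) z / of_real (kdiag n z)"
  have "poly (bp n - smult \<alpha> K) z = 0"
    using kdiag_pos[of n z] by (simp add: K_def \<alpha>_def poly_kernel_self)
  then obtain R where R: "bp n - smult \<alpha> K = [:- z, 1:] * R"
    unfolding poly_eq_0_iff_dvd by (elim dvdE)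
  have orth: "ip R (bp n) = 0"
  proof (cases "R = 0")
    case True then show ?thesis by (simp add: ip_zero_left)
  next
    case False
    then have "degree ([:- z, 1:] * R) = Suc (degree R)" by (subst degree_mult_eq) auto
    moreover have "degree (bp n - smult \<alpha> K) \<le> n"
      unfolding K_def using degree_kernel[of n z]
      by (intro degree_diff_le) (auto intro: order_trans[OF degree_smult_le])
    ultimately have "degree R < n" using R by simp
    then have "ip (bp n) R = 0" by (rule bp_orthogonal)
    then show ?thesis using ip_cnj[of "bp n" R] by simp
  qed
  \<comment> \<open>The factor \<open>a - z\<close> makes the weight
    \<open>(a - z) / (w - z)\<close> at most 1 in modulus and at least \<open>c\<close> in real part
    on \<open>E\<close>.\<close>
  define f where "f = (\<lambda>w. poly (smult (a - z) R) w * cnj (poly (bp n) w))"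
  \<comment> \<open>A minorant of \<open>Re (f w)\<close>: the mixed term is split by the
    arithmetic-geometric mean with weight \<open>t\<close>, which balances the norms 1 of
    \<open>bp n\<close> and \<open>t\<close> of \<open>K\<close>. So \<open>g\<close> integrates to
    \<open>c - cmod \<alpha> * t\<close>, while \<open>f\<close> integrates to 0.\<close>
  define g where "g = (\<lambda>w. c * (cmod (poly (bp n) w))\<^sup>2
    - cmod \<alpha> / 2 * (t * (cmod (poly (bp n) w))\<^sup>2 + (cmod (poly K w))\<^sup>2 / t))"
  have "g w \<le> Re (f w)" if w: "w \<in> E" for w
  proof -
    let ?p = "poly (bp n) w" and ?k = "poly K w"
    have wz: "w - z \<noteq> 0" "\<delta> \<le> cmod (w - z)" using geom(1)[OF w] \<delta> by auto
    have "poly (bp n - smult \<alpha> K) w = (w - z) * poly R w"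
      unfolding R by (simp add: algebra_simps)
    then have Rw: "poly R w = (?p - \<alpha> * ?k) / (w - z)" using wz by (simp add: field_simps)
    have "f w = (a - z) / (w - z) * (?p * cnj ?p) - (a - z) / (w - z) * (\<alpha> * ?k * cnj ?p)"
      unfolding f_def poly_smult Rw by (simp add: algebra_simps diff_divide_distrib)
    then have fw: "Re (f w) = Re ((a - z) / (w - z)) * (cmod ?p)\<^sup>2 - Re ((a - z) / (w - z) * (\<alpha> * ?k * cnj ?p))"
      by (simp only: complex_norm_square[symmetric] minus_complex.sel times_complex.sel Re_complex_of_real Im_complex_of_real mult_zero_right diff_zero)
    have "cmod ((a - z) / (w - z)) \<le> 1"
      using wz \<delta> by (simp add: norm_divide \<delta>_def dist_norm norm_minus_commute)
    then have "cmod ((a - z) / (w - z) * (\<alpha> * ?k * cnj ?p)) \<le> 1 * (cmod \<alpha> * cmod ?k * cmod ?p)"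
      unfolding norm_mult by (intro mult_mono) auto
    then have "Re ((a - z) / (w - z) * (\<alpha> * ?k * cnj ?p)) \<le> cmod \<alpha> * (cmod ?k * cmod ?p)"
      using complex_Re_le_cmod[of "(a - z) / (w - z) * (\<alpha> * ?k * cnj ?p)"] by (simp add: mult.assoc)
    also have "\<dots> \<le> cmod \<alpha> * ((t * (cmod ?p)\<^sup>2 + (cmod ?k)\<^sup>2 / t) / 2)"
    proof (rule mult_left_mono)
      have "0 \<le> (t * cmod ?p - cmod ?k)\<^sup>2 / t" using t(1) by simp
      also have "\<dots> = t * (cmod ?p)\<^sup>2 + (cmod ?k)\<^sup>2 / t - 2 * (cmod ?k * cmod ?p)"
        using t(1) by (simp add: field_simps power2_eq_square)
      finally show "cmod ?k * cmod ?p \<le> (t * (cmod ?p)\<^sup>2 + (cmod ?k)\<^sup>2 / t) / 2" by simp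
    qed simp
    finally have "Re ((a - z) / (w - z) * (\<alpha> * ?k * cnj ?p)) \<le> cmod \<alpha> / 2 * (t * (cmod ?p)\<^sup>2 + (cmod ?k)\<^sup>2 / t)"
      by simp
    moreover have "c * (cmod ?p)\<^sup>2 \<le> Re ((a - z) / (w - z)) * (cmod ?p)\<^sup>2"
      using geom(2)[OF w] by (intro mult_right_mono) auto
    ultimately show ?thesis unfolding g_def fw by linarith
  qed
  then have "(LINT w:E|lebesgue. g w) \<le> (LINT w:E|lebesgue. Re (f w))"
    unfolding g_def f_def using t(1)
    by (intro set_integral_mono integrable_continuous continuous_intros) auto
  also have "\<dots> = Re (ip (smult (a - z) R) (bp n))"
    using integral_Re[OF integrable_ip[of "smult (a - z) R" "bp n", unfolded set_integrable_def]]
    by (simp add: poly_inner_def area_inner_def set_lebesgue_integral_def f_def)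
  also have "\<dots> = 0" by (simp add: ip_smult_left orth)
  also have "(LINT w:E|lebesgue. g w) = c * sqnorm E (bp n) - cmod \<alpha> / 2 * (t * sqnorm E (bp n) + sqnorm E K / t)"
    unfolding g_def sqnorm_def
    by (simp add: set_integral_diff(2) set_integral_add(2) set_integrable_norm_poly[OF bounded_E sets_E])
  also have "\<dots> = c - cmod \<alpha> * t"
    using t unfolding sqnorm_bp K_def sqnorm_kernel t(2)[symmetric] by (simp add: power2_eq_square)
  finally have "c \<le> cmod \<alpha> * t" by simp
  also have "\<dots> = cmod (poly (bp n) z) / t"
  proof -
    have "cmod \<alpha> = cmod (poly (bp n) z) / t\<^sup>2"
      unfolding \<alpha>_def t(2) using kdiag_pos[of n z] by (simp add: norm_divide)
    then show ?thesis using t(1) by (simp add: power2_eq_square)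
  qed
  finally have "c * t \<le> cmod (poly (bp n) z)" using t(1) by (simp add: field_simps)
  then have "t \<le> cmod (poly (bp n) z) / c" using \<open>c > 0\<close> by (simp add: field_simps)
  also have "\<dots> = (1 + M / \<delta>)\<^sup>2 * cmod (poly (bp n) z)"
  proof -
    have "1 / c = (1 + M / \<delta>)\<^sup>2"
      using \<delta> \<open>M \<ge> 0\<close> unfolding c_def by (simp add: field_simps)
    then show ?thesis by (simp add: divide_inverse)
  qed
  also have "\<dots> \<le> (1 + M / d)\<^sup>2 * cmod (poly (bp n) z)"
    using \<delta> \<open>d > 0\<close> \<open>M \<ge> 0\<close> by (intro mult_right_mono power_mono add_left_mono divide_left_mono) auto
  finally show ?thesis by (simp add: t_def)
qed

end

section \<open>Removing a compact set\<close>

locale removed_compact = G: planar_domain G for G +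
  fixes K :: "complex set"
  assumes compact_K: "compact K" and K_subset: "K \<subseteq> G"
begin

sublocale S: planar_domain "G - K"
proof
  show "open (G - K)" using G.open_E compact_K by (simp add: open_Diff compact_imp_closed)
  show "bounded (G - K)" using G.bounded_E by (rule bounded_diff)
  show "G - K \<noteq> {}"
  proof
    assume "G - K = {}"
    then have "G = K" using K_subset by blast
    then have "closed G" using compact_K compact_imp_closed by blast
    then have "G = UNIV" using clopen[of G] G.open_E G.nonempty_E by blast
    then show False using G.bounded_E not_bounded_UNIV by blast
  qed
qed

lemma sets_K: "K \<in> sets lebesgue" and bounded_K: "bounded K"
  using compact_K by (simp_all add: borel_compact compact_imp_bounded)

lemma sqnorm_split: "sqnorm G p = sqnorm (G - K) p + sqnorm K p"
  using sqnorm_Diff[OF G.bounded_E G.sets_E sets_K K_subset] .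

text \<open>Applied to the kernel at \<open>z\<close> itself, the pointwise bound says that the
  square of \<open>kdiag\<close> is at most \<open>C\<close> times \<open>kdiag\<close>, with
  \<open>C\<close> independent of \<open>n\<close>.\<close>

lemma kdiag_bounded_on_K:
  obtains C where "C > 0" "\<And>n z. z \<in> K \<Longrightarrow> S.kdiag n z \<le> C"
proof -
  obtain C where C: "C > 0" "\<And>p z. z \<in> K \<Longrightarrow> (cmod (poly p z))\<^sup>2 \<le> C * sqnorm (G - K) p"
    using poly_bound_on_removed_compact[OF G.open_E G.bounded_E compact_K K_subset] by blast
  have "S.kdiag n z \<le> C" if "z \<in> K" for n z
    using C(2)[OF that, of "S.kernel n z"] S.kdiag_pos[of n z]
    by (simp add: S.poly_kernel_self S.sqnorm_kernel power2_eq_square)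
  then show ?thesis using C(1) that by blast
qed

section \<open>Mass of the Bergman polynomials on the removed set\<close>

lemma sum_sqnorm_K:
  "(\<Sum>k\<in>A. sqnorm K (p k)) = (LINT z:K|lebesgue. \<Sum>k\<in>A. (cmod (poly (p k) z))\<^sup>2)"
  unfolding sqnorm_def by (intro set_integral_sum[symmetric] set_integrable_norm_poly bounded_K sets_K)

text \<open>Partial sums are integrals of \<open>kdiag\<close> over \<open>K\<close>, hence at most
  \<open>C\<close> times the area of \<open>K\<close>.\<close>

lemma summable_sqnorm_K: "summable (\<lambda>k. sqnorm K (S.bp k))"
proof -
  obtain C where C: "C > 0" "\<And>n z. z \<in> K \<Longrightarrow> S.kdiag n z \<le> C"
    using kdiag_bounded_on_K by blast
  have int: "set_integrable lebesgue K f" if "continuous_on UNIV f" for f :: "complex \<Rightarrow> real"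
    using that by (intro set_integrable_continuous_bounded bounded_K sets_K) (auto intro: continuous_on_subset)
  have "(\<Sum>k\<le>n. sqnorm K (S.bp k)) \<le> (LINT z:K|lebesgue. C)" for n
    unfolding sum_sqnorm_K using C(2)
    by (intro set_integral_mono int continuous_intros) (auto simp: S.kdiag_def)
  then show ?thesis by (intro bounded_imp_summable sqnorm_nonneg)
qed

lemma sqnorm_K_bp_tendsto_0: "(\<lambda>n. sqnorm K (S.bp n)) \<longlonglongrightarrow> 0"
  by (rule summable_LIMSEQ_zero[OF summable_sqnorm_K])

section \<open>Leading coefficients and distance in norm\<close>

lemma sqnorm_G_bp: "sqnorm G (S.bp n) = 1 + sqnorm K (S.bp n)"
  by (simp add: sqnorm_split S.sqnorm_bp)

text \<open>Used in both directions: a nonnegative left side bounds the ratio from above, and a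
  ratio of at least 1 bounds the left side.\<close>

lemma sqnorm_bp_diff:
  "sqnorm G (S.bp n - G.bp n) = 2 + sqnorm K (S.bp n) - 2 * (S.gam n / G.gam n)"
proof -
  have "G.ip (S.bp n) (G.bp n) = of_real (S.gam n / G.gam n)"
    by (simp add: G.ip_bp_eq_coeff S.lead_coeff_bp)
  then show ?thesis by (simp add: G.sqnorm_diff sqnorm_G_bp G.sqnorm_bp)
qed

text \<open>Expand the norm of the difference over the smaller set, where \<open>G.bp n\<close> has
  norm at most 1.\<close>

lemma gam_le: "G.gam n \<le> S.gam n"
proof -
  have "S.ip (G.bp n) (S.bp n) = of_real (G.gam n / S.gam n)"
    by (simp add: S.ip_bp_eq_coeff G.lead_coeff_bp)
  then have "0 \<le> sqnorm (G - K) (G.bp n) + 1 - 2 * (G.gam n / S.gam n)"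
    using sqnorm_nonneg[of "G - K" "G.bp n - S.bp n"] by (simp add: S.sqnorm_diff S.sqnorm_bp)
  moreover have "sqnorm (G - K) (G.bp n) \<le> 1"
    using sqnorm_split[of "G.bp n"] sqnorm_nonneg[of K "G.bp n"] by (simp add: G.sqnorm_bp)
  ultimately have "G.gam n / S.gam n \<le> 1" by simp
  then show ?thesis using S.gam_pos[of n] by simp
qed

lemma gam_ratio_bounds:
  "1 \<le> S.gam n / G.gam n" "S.gam n / G.gam n \<le> 1 + sqnorm K (S.bp n) / 2"
  using gam_le[of n] G.gam_pos[of n] sqnorm_bp_diff[of n] sqnorm_nonneg[of G "S.bp n - G.bp n"]
  by simp_all

lemma gam_ratio_tendsto: "(\<lambda>n. S.gam n / G.gam n) \<longlonglongrightarrow> 1"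
proof (rule tendsto_sandwich[of "\<lambda>n. 1" _ _ "\<lambda>n. 1 + sqnorm K (S.bp n) / 2"])
  show "(\<lambda>n. 1 + sqnorm K (S.bp n) / 2) \<longlonglongrightarrow> 1"
    using tendsto_add[OF tendsto_const tendsto_divide[OF sqnorm_K_bp_tendsto_0 tendsto_const[of 2]], of 1] by simp
qed (use gam_ratio_bounds in auto)

lemma sqnorm_bp_diff_le: "sqnorm G (S.bp n - G.bp n) \<le> sqnorm K (S.bp n)"
  using sqnorm_bp_diff[of n] gam_ratio_bounds(1)[of n] by simp

lemma sqrt_sqnorm_K_tendsto_0: "(\<lambda>n. sqrt (sqnorm K (S.bp n))) \<longlonglongrightarrow> 0"
  using tendsto_real_sqrt[OF sqnorm_K_bp_tendsto_0] by simp

lemma area_norm_bp_diff_tendsto: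
  "(\<lambda>n. area_norm G (\<lambda>z. poly (S.bp n) z - poly (G.bp n) z)) \<longlonglongrightarrow> 0"
proof (rule tendsto_sandwich[OF _ _ tendsto_const sqrt_sqnorm_K_tendsto_0])
  have eq: "area_norm G (\<lambda>z. poly (S.bp n) z - poly (G.bp n) z) = sqrt (sqnorm G (S.bp n - G.bp n))" for n
    unfolding area_norm_poly[symmetric] by (rule arg_cong[of _ _ "area_norm G"]) auto
  show "\<forall>\<^sub>F n in sequentially. 0 \<le> area_norm G (\<lambda>z. poly (S.bp n) z - poly (G.bp n) z)"
    by (simp add: eq sqnorm_nonneg)
  show "\<forall>\<^sub>F n in sequentially. area_norm G (\<lambda>z. poly (S.bp n) z - poly (G.bp n) z) \<le> sqrt (sqnorm K (S.bp n))"
    by (simp add: eq sqnorm_bp_diff_le)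
qed

section \<open>Comparison of the two kernels\<close>

lemma kdiag_le: "G.kdiag n z \<le> S.kdiag n z"
proof -
  have "(G.kdiag n z)\<^sup>2 \<le> sqnorm (G - K) (G.kernel n z) * S.kdiag n z"
    using S.norm_poly_le_kdiag[OF G.degree_kernel, of n z z] by (simp add: G.poly_kernel_self)
  also have "\<dots> \<le> G.kdiag n z * S.kdiag n z"
    using sqnorm_split[of "G.kernel n z"] sqnorm_nonneg[of K "G.kernel n z"] S.kdiag_pos[of n z]
    by (intro mult_right_mono) (auto simp: G.sqnorm_kernel)
  finally show ?thesis using G.kdiag_pos[of n z] by (simp add: power2_eq_square)
qed

text \<open>Over \<open>G\<close> the kernel of \<open>G - K\<close> has squared norm
  \<open>x + y\<close>, so as a competitor it gives
  \<open>x * x \<le> (x + y) * G.kdiag n z\<close>; then \<open>kdiag_le\<close> replaces the factor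
  at \<open>y\<close> by \<open>x\<close>.\<close>

lemma kdiag_ratio_bound:
  "\<bar>G.kdiag n z / S.kdiag n z - 1\<bar> \<le> sqnorm K (S.kernel n z) / S.kdiag n z"
proof -
  define x y where "x = S.kdiag n z" and "y = sqnorm K (S.kernel n z)"
  have x: "x > 0" using S.kdiag_pos by (simp add: x_def)
  have y: "y \<ge> 0" by (simp add: y_def sqnorm_nonneg)
  have "x\<^sup>2 \<le> (x + y) * G.kdiag n z"
    using G.norm_poly_le_kdiag[OF S.degree_kernel, of n z z]
    by (simp add: S.poly_kernel_self sqnorm_split S.sqnorm_kernel x_def y_def)
  moreover have "y * G.kdiag n z \<le> y * x"
    using y kdiag_le[of n z] by (intro mult_left_mono) (auto simp: x_def)
  ultimately have "x * x \<le> x * (G.kdiag n z + y)" by (simp add: algebra_simps power2_eq_square)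
  then have "x - G.kdiag n z \<le> y" using x by simp
  then have "(x - G.kdiag n z) / x \<le> y / x" using x by (intro divide_right_mono) auto
  then have "1 - G.kdiag n z / x \<le> y / x" using x by (simp add: diff_divide_distrib)
  moreover have "G.kdiag n z / x \<le> 1" using kdiag_le[of n z] x by (simp add: x_def)
  ultimately show ?thesis by (simp add: x_def y_def)
qed

text \<open>Split the kernel at \<open>N\<close>: the head is controlled by \<open>K\<^sub>N(z,z)\<close>, which is negligible against \<open>K\<^sub>n(z,z)\<close> off the closure, and the tail by the convergent series \<open>\<Sum>k. \<parallel>p\<^sub>k\<parallel>\<^sup>2\<close> over \<open>K\<close>.\<close>
lemma sqnorm_K_kernel_le:
  assumes C: "\<And>n z. z \<in> K \<Longrightarrow> S.kdiag n z \<le> C" and "N \<le> n"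
  shows "sqnorm K (S.kernel n z) \<le> 2 * (C * measure lebesgue K) * S.kdiag N z
    + 2 * (\<Sum>k\<in>{N<..n}. sqnorm K (S.bp k)) * S.kdiag n z"
proof -
  \<comment> \<open>The factors 2 come from bounding the square of head plus tail by twice the sum
    of their squares.\<close>
  let ?g = "\<lambda>w. 2 * (S.kdiag N z * C) + 2 * S.kdiag n z * (\<Sum>k\<in>{N<..n}. (cmod (poly (S.bp k) w))\<^sup>2)"
  have int: "set_integrable lebesgue K f" if "continuous_on UNIV f" for f :: "complex \<Rightarrow> real"
    using that by (intro set_integrable_continuous_bounded bounded_K sets_K) (auto intro: continuous_on_subset)
  have split: "{..n} = {..N} \<union> {N<..n}" using assms(2) by auto
  have le: "(cmod (poly (S.kernel n z) w))\<^sup>2 \<le> ?g w" if w: "w \<in> K" for w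
  proof -
    define b where "b = (\<Sum>k\<in>{N<..n}. cnj (poly (S.bp k) z) * poly (S.bp k) w)"
    have eq: "poly (S.kernel n z) w = poly (S.kernel N z) w + b"
      unfolding S.poly_kernel b_def split by (subst sum.union_disjoint) auto
    have "(cmod (poly (S.kernel N z) w))\<^sup>2 \<le> S.kdiag N z * S.kdiag N w"
      using S.norm_poly_le_kdiag[OF S.degree_kernel, of N z w] by (simp add: S.sqnorm_kernel)
    also have "\<dots> \<le> S.kdiag N z * C"
      using C[OF w] S.kdiag_pos[of N z] by (intro mult_left_mono) auto
    finally have 1: "(cmod (poly (S.kernel N z) w))\<^sup>2 \<le> S.kdiag N z * C" .
    have "cmod b \<le> (\<Sum>k\<in>{N<..n}. cmod (poly (S.bp k) z) * cmod (poly (S.bp k) w))"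
      unfolding b_def by (rule order_trans[OF norm_sum]) (simp add: norm_mult)
    then have "(cmod b)\<^sup>2 \<le> (\<Sum>k\<in>{N<..n}. cmod (poly (S.bp k) z) * cmod (poly (S.bp k) w))\<^sup>2"
      by (intro power_mono) auto
    also have "\<dots> \<le> (\<Sum>k\<in>{N<..n}. (cmod (poly (S.bp k) z))\<^sup>2) * (\<Sum>k\<in>{N<..n}. (cmod (poly (S.bp k) w))\<^sup>2)"
      by (rule Cauchy_Schwarz_ineq_sum)
    also have "\<dots> \<le> S.kdiag n z * (\<Sum>k\<in>{N<..n}. (cmod (poly (S.bp k) w))\<^sup>2)"
      unfolding S.kdiag_def by (intro mult_right_mono sum_mono2 sum_nonneg) auto
    finally have 2: "(cmod b)\<^sup>2 \<le> S.kdiag n z * (\<Sum>k\<in>{N<..n}. (cmod (poly (S.bp k) w))\<^sup>2)" .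
    have "(cmod (poly (S.kernel n z) w))\<^sup>2 \<le> (cmod (poly (S.kernel N z) w) + cmod b)\<^sup>2"
      unfolding eq by (intro power_mono norm_triangle_ineq) auto
    also have "\<dots> \<le> 2 * (cmod (poly (S.kernel N z) w))\<^sup>2 + 2 * (cmod b)\<^sup>2"
      using zero_le_power2[of "cmod (poly (S.kernel N z) w) - cmod b"]
      by (simp add: power2_sum power2_diff)
    finally show ?thesis using 1 2 by linarith
  qed
  have "sqnorm K (S.kernel n z) \<le> (LINT w:K|lebesgue. ?g w)"
    unfolding sqnorm_def using le by (intro set_integral_mono int continuous_intros)
  also have "\<dots> = (LINT w:K|lebesgue. 2 * (S.kdiag N z * C))
      + (LINT w:K|lebesgue. 2 * S.kdiag n z * (\<Sum>k\<in>{N<..n}. (cmod (poly (S.bp k) w))\<^sup>2))"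
    by (intro set_integral_add(2) int continuous_intros)
  also have "(LINT w:K|lebesgue. 2 * (S.kdiag N z * C)) = 2 * (C * measure lebesgue K) * S.kdiag N z"
    using set_integral_const[of K lebesgue "2 * (S.kdiag N z * C)"] sets_K
      fmeasurableD2[OF lmeasurable_compact[OF compact_K]] by (simp add: mult_ac)
  also have "(LINT w:K|lebesgue. 2 * S.kdiag n z * (\<Sum>k\<in>{N<..n}. (cmod (poly (S.bp k) w))\<^sup>2))
      = 2 * (\<Sum>k\<in>{N<..n}. sqnorm K (S.bp k)) * S.kdiag n z"
    unfolding sum_sqnorm_K by simp
  finally show ?thesis .
qed

lemma kdiag_ratio_uniform:
  assumes "connected (- closure G)" "closed T" "T \<inter> closure G = {}" "\<epsilon> > 0"
  shows "\<forall>\<^sub>F n in sequentially. \<forall>z\<in>T. \<bar>G.kdiag n z / S.kdiag n z - 1\<bar> < \<epsilon>"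
proof -
  obtain C where C: "C > 0" "\<And>n z. z \<in> K \<Longrightarrow> S.kdiag n z \<le> C"
    using kdiag_bounded_on_K by blast
  obtain N where N: "\<And>m n. m \<ge> N \<Longrightarrow> norm (\<Sum>k\<in>{m..<n}. sqnorm K (S.bp k)) < \<epsilon> / 8"
    using summable_sqnorm_K[unfolded summable_Cauchy, rule_format, of "\<epsilon> / 8"] assms(4) by auto
  have tail: "(\<Sum>k\<in>{N<..n}. sqnorm K (S.bp k)) \<le> \<epsilon> / 8" for n
  proof -
    have "{N<..n} = {Suc N..<Suc n}" by auto
    then show ?thesis using N[of "Suc N" "Suc n"] by (simp add: abs_less_iff)
  qed
  \<comment> \<open>Adding 1 keeps \<open>\<kappa>\<close> positive even if \<open>K\<close> has
    area 0. With \<open>e\<close> as chosen next, the head contributes at most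
    \<open>\<epsilon> / 4\<close>, and so does the tail, giving \<open>\<epsilon> / 2\<close> in
    total.\<close>
  define \<kappa> where "\<kappa> = C * measure lebesgue K + 1"
  have "\<kappa> > 0" using C(1) by (auto simp: \<kappa>_def intro: add_nonneg_pos)
  define e where "e = sqrt (\<epsilon> / (8 * \<kappa>))"
  have e: "e > 0" "e\<^sup>2 = \<epsilon> / (8 * \<kappa>)" using \<open>\<kappa> > 0\<close> assms(4) by (auto simp: e_def)
  have "compact (closure G)" using G.bounded_E by (simp add: compact_closure)
  then obtain d where d: "\<And>z. z \<in> T \<Longrightarrow>
      \<exists>Q. degree Q \<le> d \<and> poly Q z = 1 \<and> (\<forall>w\<in>closure G. cmod (poly Q w) \<le> e)"
    using exists_poly_small_on_compact[OF _ assms(1-3) e(1)] by blast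
  show ?thesis
    using eventually_ge_at_top[of "N + d"]
  proof eventually_elim
    fix n assume n: "N + d \<le> n"
    show "\<forall>z\<in>T. \<bar>G.kdiag n z / S.kdiag n z - 1\<bar> < \<epsilon>"
    proof
      fix z assume "z \<in> T"
      then obtain Q where Q: "degree Q \<le> d" "poly Q z = 1" "\<And>w. w \<in> closure G \<Longrightarrow> cmod (poly Q w) \<le> e"
        using d by blast
      have "S.kdiag N z \<le> e\<^sup>2 * S.kdiag (N + d) z"
        using Q e(1) closure_subset[of G] by (intro S.kdiag_le_of_small_poly[of Q]) auto
      also have "\<dots> \<le> e\<^sup>2 * S.kdiag n z"
        using S.kdiag_mono[OF n] by (intro mult_left_mono) auto
      finally have head: "S.kdiag N z \<le> e\<^sup>2 * S.kdiag n z" .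
      have "sqnorm K (S.kernel n z) \<le> 2 * (C * measure lebesgue K) * S.kdiag N z
          + 2 * (\<Sum>k\<in>{N<..n}. sqnorm K (S.bp k)) * S.kdiag n z"
        using C(2) n by (intro sqnorm_K_kernel_le) auto
      also have "\<dots> \<le> 2 * \<kappa> * (e\<^sup>2 * S.kdiag n z) + 2 * (\<epsilon> / 8) * S.kdiag n z"
        using head tail[of n] assms(4) C(1) S.kdiag_pos[of n z] S.kdiag_pos[of N z] \<open>\<kappa> > 0\<close>
        by (intro add_mono mult_mono mult_left_mono) (auto simp: \<kappa>_def sum_nonneg sqnorm_nonneg)
      also have "\<dots> = \<epsilon> / 2 * S.kdiag n z"
        using \<open>\<kappa> > 0\<close> unfolding e(2) by (simp add: field_simps)
      finally have "sqnorm K (S.kernel n z) / S.kdiag n z \<le> \<epsilon> / 2"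
        using S.kdiag_pos[of n z] by (simp add: pos_divide_le_eq)
      then show "\<bar>G.kdiag n z / S.kdiag n z - 1\<bar> < \<epsilon>"
        using kdiag_ratio_bound[of n z] assms(4) by linarith
    qed
  qed
qed

text \<open>Each \<open>kdiag\<close> is asymptotic to the squared modulus of its top term. The
  limit is the value of the Christoffel ratio at infinity.\<close>

lemma kdiag_ratio_at_infinity:
  "((\<lambda>z. G.kdiag n z / S.kdiag n z) \<longlongrightarrow> (G.gam n / S.gam n)\<^sup>2) at_infinity"
proof -
  let ?g = "\<lambda>z. (cmod (poly (G.bp n) z))\<^sup>2" and ?s = "\<lambda>z. (cmod (poly (S.bp n) z))\<^sup>2"
  have r: "((\<lambda>z. (cmod (poly p z / poly q z))\<^sup>2) \<longlongrightarrow> (cmod (lead_coeff p / lead_coeff q))\<^sup>2) at_infinity"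
    if "degree p = degree q" "q \<noteq> 0" for p q :: "complex poly"
    using that by (intro tendsto_power tendsto_norm poly_ratio_tendsto_at_infinity)
  have gs: "((\<lambda>z. ?g z / ?s z) \<longlongrightarrow> (G.gam n / S.gam n)\<^sup>2) at_infinity"
    using r[of "G.bp n" "S.bp n"] G.gam_pos[of n] S.gam_pos[of n]
    by (simp add: norm_divide power_divide G.lead_coeff_bp S.lead_coeff_bp)
  have "((\<lambda>z. (G.kdiag n z / ?g z) * (?g z / ?s z) / (S.kdiag n z / ?s z)) \<longlongrightarrow> 1 * (G.gam n / S.gam n)\<^sup>2 / 1) at_infinity"
    by (intro tendsto_divide tendsto_mult G.kdiag_tendsto_at_infinity S.kdiag_tendsto_at_infinity gs) simp
  moreover have "\<forall>\<^sub>F z in at_infinity. (G.kdiag n z / ?g z) * (?g z / ?s z) / (S.kdiag n z / ?s z) = G.kdiag n z / S.kdiag n z"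
  proof -
    have nz: "\<forall>\<^sub>F z in at_infinity. poly p z \<noteq> 0" if "p \<noteq> 0" for p :: "complex poly"
    proof -
      have "((\<lambda>z. poly p z / poly p z) \<longlongrightarrow> 1) at_infinity"
        using poly_ratio_tendsto_at_infinity[of p p] that by simp
      then have "\<forall>\<^sub>F z in at_infinity. poly p z / poly p z \<noteq> 0"
        by (rule tendsto_imp_eventually_ne) simp
      then show ?thesis by eventually_elim auto
    qed
    show ?thesis
      using nz[OF G.bp_nonzero[of n]] nz[OF S.bp_nonzero[of n]]
      by eventually_elim simp
  qed
  ultimately show ?thesis by (auto intro: Lim_transform_eventually)
qed

section \<open>Uniform convergence on compact subsets of the sphere\<close>

lemma christoffel_ratio_uniform_limit:
  assumes "connected (- closure G)" "compactin riemann_sphere T" "T \<inter> Some ` closure G = {}"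
  shows "uniform_limit T (\<lambda>n. sphere_ext (\<lambda>z. christoffel (G - K) n z / christoffel G n z)) (\<lambda>w. 1) sequentially"
  unfolding uniform_limit_iff
proof (intro allI impI)
  fix \<epsilon> :: real assume "\<epsilon> > 0"
  have f: "christoffel (G - K) n z / christoffel G n z = G.kdiag n z / S.kdiag n z" for n z
    by (simp add: S.christoffel_eq G.christoffel_eq)
  have inf: "Lim at_infinity (\<lambda>z. G.kdiag n z / S.kdiag n z) = (G.gam n / S.gam n)\<^sup>2" for n
    using kdiag_ratio_at_infinity by (intro tendsto_Lim trivial_limit_at_infinity)
  have "(\<lambda>n. (1 / (S.gam n / G.gam n))\<^sup>2) \<longlonglongrightarrow> (1 / 1)\<^sup>2"
    by (intro tendsto_intros gam_ratio_tendsto) simp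
  then have "(\<lambda>n. (G.gam n / S.gam n)\<^sup>2) \<longlonglongrightarrow> 1" by simp
  then have "\<forall>\<^sub>F n in sequentially. dist ((G.gam n / S.gam n)\<^sup>2) 1 < \<epsilon>"
    using \<open>\<epsilon> > 0\<close> by (rule tendstoD)
  moreover have "\<forall>\<^sub>F n in sequentially. \<forall>z\<in>Some -` T. \<bar>G.kdiag n z / S.kdiag n z - 1\<bar> < \<epsilon>"
    using assms \<open>\<epsilon> > 0\<close> by (intro kdiag_ratio_uniform closed_vimage_Some_compactin) auto
  ultimately show "\<forall>\<^sub>F n in sequentially. \<forall>w\<in>T.
      dist (sphere_ext (\<lambda>z. christoffel (G - K) n z / christoffel G n z) w) 1 < \<epsilon>"
  proof eventually_elim
    case (elim n)
    show ?case
    proof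
      fix w assume "w \<in> T"
      then show "dist (sphere_ext (\<lambda>z. christoffel (G - K) n z / christoffel G n z) w) 1 < \<epsilon>"
      proof (cases w)
        case None
        then show ?thesis using elim by (simp add: sphere_ext_def f inf)
      next
        case (Some z)
        then show ?thesis using elim \<open>w \<in> T\<close> by (simp add: sphere_ext_def f dist_real_def)
      qed
    qed
  qed
qed

text \<open>At a finite point the difference is at most its norm over \<open>G\<close> times the
  root of \<open>kdiag\<close>, which is at most \<open>L\<close> times the modulus of
  \<open>G.bp n\<close>. The positive distance from the finite part of \<open>T\<close> to the hull
  makes \<open>L\<close> uniform.\<close>

lemma bp_ratio_uniform_limit:
  assumes "compactin riemann_sphere T" "T \<inter> Some ` (convex hull (closure G)) = {}"
  shows "uniform_limit T (\<lambda>n. sphere_ext (\<lambda>z. poly (S.bp n) z / poly (G.bp n) z)) (\<lambda>w. 1) sequentially"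
  unfolding uniform_limit_iff
proof (intro allI impI)
  fix \<epsilon> :: real assume "\<epsilon> > 0"
  define H where "H = convex hull (closure G)"
  have "compact H" using G.bounded_E by (simp add: H_def compact_convex_hull compact_closure)
  have "Some -` T \<inter> H = {}" using assms(2) by (auto simp: H_def)
  then obtain d where d: "d > 0" "\<And>z w. z \<in> Some -` T \<Longrightarrow> w \<in> H \<Longrightarrow> d \<le> dist z w"
    using separate_closed_compact[OF closed_vimage_Some_compactin[OF assms(1)] \<open>compact H\<close>] by blast
  define L where "L = (1 + diameter H / d)\<^sup>2"
  have M: "dist v w \<le> diameter H" if "v \<in> H" "w \<in> H" for v w
    using diameter_bounded_bound[OF compact_imp_bounded[OF \<open>compact H\<close>] that] .
  have fin: "cmod (poly (S.bp n) z / poly (G.bp n) z - 1) \<le> sqrt (sqnorm K (S.bp n)) * L"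
    if z: "z \<in> Some -` T" for n z
  proof -
    have k: "sqrt (G.kdiag n z) \<le> L * cmod (poly (G.bp n) z)"
      unfolding L_def using d z M by (intro G.sqrt_kdiag_le_bp) (auto simp: H_def)
    \<comment> \<open>A positive kernel bounded by the polynomial rules out zeros of
      \<open>G.bp n\<close> off the hull.\<close>
    then have nz: "cmod (poly (G.bp n) z) > 0"
      using G.kdiag_pos[of n z] by (cases "poly (G.bp n) z = 0") auto
    have "(cmod (poly (S.bp n - G.bp n) z))\<^sup>2 \<le> sqnorm G (S.bp n - G.bp n) * G.kdiag n z"
      by (intro G.norm_poly_le_kdiag degree_diff_le) auto
    also have "\<dots> \<le> sqnorm K (S.bp n) * G.kdiag n z"
      using sqnorm_bp_diff_le G.kdiag_pos[of n z] by (intro mult_right_mono) auto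
    finally have "cmod (poly (S.bp n - G.bp n) z) \<le> sqrt (sqnorm K (S.bp n)) * sqrt (G.kdiag n z)"
      unfolding real_sqrt_mult[symmetric] by (rule real_le_rsqrt)
    also have "\<dots> \<le> sqrt (sqnorm K (S.bp n)) * (L * cmod (poly (G.bp n) z))"
      using k by (intro mult_left_mono) (auto simp: sqnorm_nonneg)
    finally have "cmod (poly (S.bp n) z - poly (G.bp n) z) / cmod (poly (G.bp n) z) \<le> sqrt (sqnorm K (S.bp n)) * L"
      using nz by (simp add: field_simps)
    moreover have "poly (S.bp n) z / poly (G.bp n) z - 1 = (poly (S.bp n) z - poly (G.bp n) z) / poly (G.bp n) z"
      using nz by (auto simp: field_simps)
    ultimately show ?thesis by (simp add: norm_divide)
  qed
  have inf: "Lim at_infinity (\<lambda>z. poly (S.bp n) z / poly (G.bp n) z) = of_real (S.gam n / G.gam n)" for n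
    using poly_ratio_tendsto_at_infinity[of "S.bp n" "G.bp n"]
    by (intro tendsto_Lim trivial_limit_at_infinity) (auto simp: S.lead_coeff_bp G.lead_coeff_bp)
  have "(\<lambda>n. complex_of_real (S.gam n / G.gam n)) \<longlonglongrightarrow> of_real 1"
    by (intro tendsto_of_real gam_ratio_tendsto)
  then have "\<forall>\<^sub>F n in sequentially. dist (complex_of_real (S.gam n / G.gam n)) 1 < \<epsilon>"
    using \<open>\<epsilon> > 0\<close> by (auto dest: tendstoD)
  moreover have "(\<lambda>n. sqrt (sqnorm K (S.bp n)) * L) \<longlonglongrightarrow> 0 * L"
    by (intro tendsto_mult_right sqrt_sqnorm_K_tendsto_0)
  then have "\<forall>\<^sub>F n in sequentially. sqrt (sqnorm K (S.bp n)) * L < \<epsilon>"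
    using \<open>\<epsilon> > 0\<close> order_tendstoD(2) by force
  ultimately show "\<forall>\<^sub>F n in sequentially. \<forall>w\<in>T.
      dist (sphere_ext (\<lambda>z. poly (S.bp n) z / poly (G.bp n) z) w) 1 < \<epsilon>"
  proof eventually_elim
    case (elim n)
    show ?case
    proof
      fix w assume "w \<in> T"
      then show "dist (sphere_ext (\<lambda>z. poly (S.bp n) z / poly (G.bp n) z) w) 1 < \<epsilon>"
      proof (cases w)
        case None
        then show ?thesis using elim by (simp add: sphere_ext_def inf)
      next
        case (Some z)
        then have "z \<in> Some -` T" using \<open>w \<in> T\<close> by simp
        from fin[OF this, of n] show ?thesis
          using elim Some by (simp add: sphere_ext_def dist_norm)
      qed
    qed
  qed
qed

end

theorem theorem2p1:
  fixes m :: nat and D :: "nat \<Rightarrow> complex set" and G K Gstar :: "complex set"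
  assumes "m \<ge> 1"
    and "\<And>j. j \<in> {1..m} \<Longrightarrow> bounded_jordan_domain (D j)"
    and "disjoint_family_on (\<lambda>j. closure (D j)) {1..m}"
    and "G = (\<Union>j\<in>{1..m}. D j)"
    and "compact K" and "K \<subseteq> G"
    and "Gstar = G - K"
  shows "((\<lambda>n. bergman_gamma Gstar n / bergman_gamma G n) \<longlonglongrightarrow> 1)
    \<and> ((\<lambda>n. area_norm G (\<lambda>z. poly (bergman_poly Gstar n) z - poly (bergman_poly G n) z)) \<longlonglongrightarrow> 0)
    \<and> (\<forall>S. compactin riemann_sphere S \<and> S \<inter> Some ` closure G = {} \<longrightarrow>
          uniform_limit S
            (\<lambda>n. sphere_ext (\<lambda>z. christoffel Gstar n z / christoffel G n z)) (\<lambda>w. 1) sequentially)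
    \<and> (\<forall>S. compactin riemann_sphere S \<and> S \<inter> Some ` (convex hull (closure G)) = {} \<longrightarrow>
          uniform_limit S
            (\<lambda>n. sphere_ext (\<lambda>z. poly (bergman_poly Gstar n) z / poly (bergman_poly G n) z)) (\<lambda>w. 1) sequentially)"
proof -
  note D = bounded_jordan_domain_properties[OF assms(2)]
  interpret removed_compact G K
  proof
    show "open G" unfolding assms(4) using D(1) by blast
    show "bounded G" unfolding assms(4) using D(2) by (intro bounded_UN) auto
    show "G \<noteq> {}" unfolding assms(4) using D(3)[of 1] assms(1) by force
  qed (use assms in auto)
  have "closure G = (\<Union>j\<in>{1..m}. closure (D j))"
  proof
    have "closed (\<Union>j\<in>{1..m}. closure (D j))" by (intro closed_UN) auto
    then show "closure G \<subseteq> (\<Union>j\<in>{1..m}. closure (D j))"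
      unfolding assms(4) using closure_subset by (intro closure_minimal) blast+
    show "(\<Union>j\<in>{1..m}. closure (D j)) \<subseteq> closure G"
      unfolding assms(4) by (intro UN_least closure_mono) auto
  qed
  moreover have "connected (- (\<Union>j\<in>{1..m}. closure (D j)))"
    using D assms(3) by (intro connected_Compl_disjoint_UN) (auto simp: compact_closure)
  ultimately have "connected (- closure G)" by simp
  then show ?thesis
    unfolding assms(7)
    by (intro conjI allI impI gam_ratio_tendsto area_norm_bp_diff_tendsto
      christoffel_ratio_uniform_limit bp_ratio_uniform_limit) auto
qed

end
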